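(* Let $B\subset\Lambda$ be a noise-type Boolean algebra and let $$\mathrm{Cl}(B)=\Bigl\{\liminf_n x_n : x_1,x_2,\ldots\in B\Bigr\}$$ be the set of lower limits of all sequences of elements of $B$. Then: (a) $\inf_n x_n\in\mathrm{Cl}(B)$ whenever $x_1,x_2,\ldots\in\mathrm{Cl}(B)$; (b) $\sup_n x_n\in\mathrm{Cl}(B)$ whenever $x_1,x_2,\ldots\in\mathrm{Cl}(B)$ and $x_1\le x_2\le\cdots$.
   Context: Let $(\Omega,\mathcal F,P)$ be a probability space with $H=L_2(\Omega,\mathcal F,P)$ (real-valued functions) separable. Every $\sigma$-field is assumed to contain all null sets. $\Lambda$ is the set of all sub-$\sigma$-fields of $\mathcal F$, partially ordered by inclusion; it is a complete lattice with $x\wedge y=x\cap y$, $x\vee y=\sigma(x,y)$ (the least $\sigma$-field containing $x$ and $y$), $\inf X=\bigcap_{x\in X}x$, $\sup X=\sigma(\bigcup_{x\in X}x)$ for $X\subset\Lambda$; its greatest element is $1_\Lambda=\mathcal F$ and its least element $0_\Lambda$ is the trivial $\sigma$-field (null sets and their complements). For arbitrary $x_1,x_2,\ldots\in\Lambda$, $\liminf_n x_n=\sup_n\inf_k x_{n+k}$. A noise-type Boolean algebra is a subset $B\subset\Lambda$ that is a sublattice (closed under $\wedge,\vee$), is distributive ($x\wedge(y\vee z)=(x\wedge y)\vee(x\wedge z)$ for $x,y,z\in B$), contains $0_\Lambda$ and $1_\Lambda$, is such that every $x\in B$ has a (necessarily unique) complement $x'\in B$ ($x\wedge x'=0_\Lambda$,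 $x\vee x'=1_\Lambda$), and such that for every $x\in B$ the $\sigma$-fields $x$ and $x'$ are independent. *)

theory Defs
  imports "HOL-Probability.Probability"
begin

text \<open>Throughout, \<open>M\<close> plays the role of \<open>(\<Omega>, F, P)\<close>, and a sub-\<open>\<sigma>\<close>-field of \<open>sets M\<close> is
  represented by the set of its members, so that the order is plain set inclusion.\<close>

definition L2_functions :: "'a measure \<Rightarrow> ('a \<Rightarrow> real) set" where
  "L2_functions M = {f \<in> borel_measurable M. integrable M (\<lambda>\<omega>. (f \<omega>)\<^sup>2)}"

definition L2_dist :: "'a measure \<Rightarrow> ('a \<Rightarrow> real) \<Rightarrow> ('a \<Rightarrow> real) \<Rightarrow> real" where
  "L2_dist M f g = sqrt (\<integral>\<omega>. (f \<omega> - g \<omega>)\<^sup>2 \<partial>M)"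

text \<open>Stated with representatives of the almost-everywhere equality classes that make up
  the Hilbert space; \<open>L2_dist M\<close> does not depend on the choice of representatives.\<close>

definition separable_L2 :: "'a measure \<Rightarrow> bool" where
  "separable_L2 M \<longleftrightarrow> (\<exists>D. countable D \<and> D \<subseteq> L2_functions M \<and>
     (\<forall>f\<in>L2_functions M. \<forall>e>0. \<exists>g\<in>D. L2_dist M f g < e))"

text \<open>\<open>M\<close> is not required to be complete: the null sets are those belonging to \<open>sets M\<close>.
  For complete \<open>M\<close> these are all null sets.\<close>

definition sigma_fields :: "'a measure \<Rightarrow> 'a set set set" where
  "sigma_fields M = {x. sigma_algebra (space M) x \<and> null_sets M \<subseteq> x \<and> x \<subseteq> sets M}"

text \<open>Generated \<open>\<sigma>\<close>-fields always include the null sets, and the infimum is intersected with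
  \<open>sets M\<close>; this makes \<open>sf_Sup M {}\<close> and \<open>sf_Inf M {}\<close> the least and the greatest element.\<close>

definition sf_generated :: "'a measure \<Rightarrow> 'a set set \<Rightarrow> 'a set set" where
  "sf_generated M C = sigma_sets (space M) (null_sets M \<union> C)"

definition sf_Inf :: "'a measure \<Rightarrow> 'a set set set \<Rightarrow> 'a set set" where
  "sf_Inf M X = sets M \<inter> \<Inter>X"

definition sf_Sup :: "'a measure \<Rightarrow> 'a set set set \<Rightarrow> 'a set set" where
  "sf_Sup M X = sf_generated M (\<Union>X)"

definition sf_join :: "'a measure \<Rightarrow> 'a set set \<Rightarrow> 'a set set \<Rightarrow> 'a set set" where
  "sf_join M x y = sf_generated M (x \<union> y)"

definition sf_bot :: "'a measure \<Rightarrow> 'a set set" where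
  "sf_bot M = {A \<in> sets M. A \<in> null_sets M \<or> space M - A \<in> null_sets M}"

definition sf_liminf :: "'a measure \<Rightarrow> (nat \<Rightarrow> 'a set set) \<Rightarrow> 'a set set" where
  "sf_liminf M x = sf_Sup M (range (\<lambda>n. sf_Inf M (range (\<lambda>k. x (n + k)))))"

definition sf_complement :: "'a measure \<Rightarrow> 'a set set \<Rightarrow> 'a set set \<Rightarrow> bool" where
  "sf_complement M x x' \<longleftrightarrow> x \<inter> x' = sf_bot M \<and> sf_join M x x' = sets M"

definition noise_type_Boolean_algebra :: "'a measure \<Rightarrow> 'a set set set \<Rightarrow> bool" where
  "noise_type_Boolean_algebra M B \<longleftrightarrow>
     B \<subseteq> sigma_fields M \<and>
     (\<forall>x\<in>B. \<forall>y\<in>B. x \<inter> y \<in> B \<and> sf_join M x y \<in> B) \<and>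
     (\<forall>x\<in>B. \<forall>y\<in>B. \<forall>z\<in>B. x \<inter> sf_join M y z = sf_join M (x \<inter> y) (x \<inter> z)) \<and>
     sf_bot M \<in> B \<and> sets M \<in> B \<and>
     (\<forall>x\<in>B. \<exists>x'\<in>B. sf_complement M x x') \<and>
     (\<forall>x\<in>B. \<forall>x'\<in>B. sf_complement M x x' \<longrightarrow> prob_space.indep_set M x x')"

definition Cl :: "'a measure \<Rightarrow> 'a set set set \<Rightarrow> 'a set set set" where
  "Cl M B = {sf_liminf M x |x. \<forall>n. x n \<in> B}"

lemma sf_generated_in:
  assumes "C \<subseteq> sets M"
  shows "sf_generated M C \<in> sigma_fields M"
proof -
  have C: "null_sets M \<union> C \<subseteq> sets M"
    using assms by auto
  then have "sigma_algebra (space M) (sf_generated M C)"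
    unfolding sf_generated_def using sets.space_closed by (intro sigma_algebra_sigma_sets) blast
  moreover have "null_sets M \<subseteq> sf_generated M C"
    unfolding sf_generated_def by (auto intro: sigma_sets.Basic)
  moreover have "sf_generated M C \<subseteq> sets M"
    unfolding sf_generated_def using C by (rule sets.sigma_sets_subset)
  ultimately show ?thesis
    by (simp add: sigma_fields_def)
qed

lemma sf_Sup_least_upper_bound:
  assumes "X \<subseteq> sigma_fields M"
  shows "sf_Sup M X \<in> sigma_fields M"
    and "x \<in> X \<Longrightarrow> x \<subseteq> sf_Sup M X"
    and "y \<in> sigma_fields M \<Longrightarrow> (\<And>x. x \<in> X \<Longrightarrow> x \<subseteq> y) \<Longrightarrow> sf_Sup M X \<subseteq> y"
proof -
  show "sf_Sup M X \<in> sigma_fields M"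
    unfolding sf_Sup_def using assms by (intro sf_generated_in) (auto simp: sigma_fields_def)
  show "x \<subseteq> sf_Sup M X" if "x \<in> X"
    using that unfolding sf_Sup_def sf_generated_def by (auto intro!: sigma_sets.Basic)
  show "sf_Sup M X \<subseteq> y" if "y \<in> sigma_fields M" "\<And>x. x \<in> X \<Longrightarrow> x \<subseteq> y"
    unfolding sf_Sup_def sf_generated_def
    using that by (intro sigma_algebra.sigma_sets_subset) (auto simp: sigma_fields_def)
qed

lemma sf_join_eq_Sup: "sf_join M x y = sf_Sup M {x, y}"
  by (simp add: sf_join_def sf_Sup_def)

lemma sf_Inf_greatest_lower_bound:
  assumes "X \<subseteq> sigma_fields M"
  shows "sf_Inf M X \<in> sigma_fields M"
    and "x \<in> X \<Longrightarrow> sf_Inf M X \<subseteq> x"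
    and "y \<in> sigma_fields M \<Longrightarrow> (\<And>x. x \<in> X \<Longrightarrow> y \<subseteq> x) \<Longrightarrow> y \<subseteq> sf_Inf M X"
proof -
  have "sigma_algebra (space M) (sets M \<inter> \<Inter>X)"
    unfolding sigma_algebra_iff2
  proof (intro conjI ballI allI impI)
    show "sets M \<inter> \<Inter>X \<subseteq> Pow (space M)"
      using sets.space_closed by blast
    show "{} \<in> sets M \<inter> \<Inter>X"
      using assms by (auto simp: sigma_fields_def sigma_algebra_iff2)
    show "space M - s \<in> sets M \<inter> \<Inter>X" if "s \<in> sets M \<inter> \<Inter>X" for s
      using assms that by (auto simp: sigma_fields_def sigma_algebra_iff2)
    show "(\<Union>i. A i) \<in> sets M \<inter> \<Inter>X" if "range A \<subseteq> sets M \<inter> \<Inter>X" for A :: "nat \<Rightarrow> _"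
    proof -
      have "(\<Union>i. A i) \<in> x" if "x \<in> X" for x
      proof -
        have "sigma_algebra (space M) x" "range A \<subseteq> x"
          using assms \<open>x \<in> X\<close> \<open>range A \<subseteq> sets M \<inter> \<Inter>X\<close> by (auto simp: sigma_fields_def subset_iff)
        then show ?thesis
          by (simp add: sigma_algebra_iff2)
      qed
      moreover have "(\<Union>i. A i) \<in> sets M"
        using that by (intro sets.countable_UN) simp
      ultimately show ?thesis by blast
    qed
  qed
  then show "sf_Inf M X \<in> sigma_fields M"
    using assms by (auto simp: sf_Inf_def sigma_fields_def)
  show "x \<in> X \<Longrightarrow> sf_Inf M X \<subseteq> x"
    by (auto simp: sf_Inf_def)
  show "y \<in> sigma_fields M \<Longrightarrow> (\<And>x. x \<in> X \<Longrightarrow> y \<subseteq> x) \<Longrightarrow> y \<subseteq> sf_Inf M X"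
    by (auto simp: sf_Inf_def sigma_fields_def)
qed

end

theory Submission
  imports Defs
begin

text \<open>Write \<open>Q\<^sub>x\<close> for conditional expectation given the \<open>\<sigma>\<close>-field \<open>x\<close>.  The whole argument rests
  on one consequence of independence: for \<open>x, y\<close> in a noise-type Boolean algebra \<open>B\<close>,
  \<open>Q\<^sub>y Q\<^sub>x = Q\<^bsub>x \<inter> y\<^esub>\<close>.  Indeed \<open>x\<close> is generated by \<open>x \<inter> y\<close> and \<open>x \<inter> y'\<close> by distributivity, and
  \<open>Q\<^sub>y\<close> averages out the second factor because \<open>y'\<close> is independent of \<open>y\<close>
  (\<open>noise_type_cexp_comp\<close>).

  The set \<open>Cl(B)\<close> is then identified with the closure \<open>K\<close> of \<open>B\<close> in the topology in which
  \<open>x\<close> is close to \<open>y\<close> when \<open>Q\<^sub>x f\<close> is close to \<open>Q\<^sub>y f\<close> for each of finitely many given \<open>f\<close>.  The theorem follows,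
  since \<open>K\<close> has both closure properties:

  \<^item> The composition rule is inherited by \<open>K\<close>, as contractions may be composed in the limit.
    This makes \<open>K\<close> closed under finite intersections (\<open>strong_closure_Int\<close>).

  \<^item> If \<open>z\<^sub>n\<close> decreases to its infimum \<open>z\<close>, or increases to its supremum \<open>z\<close>, then
    \<open>Q\<^bsub>z\<^sub>n\<^esub> f \<rightarrow> Q\<^sub>z f\<close> (\<open>cexp_converges_decreasing\<close>, \<open>cexp_converges_increasing\<close>).
    Hence \<open>K\<close> is closed under countable infima and under increasing suprema, and in particular
    contains every lower limit of elements of \<open>B\<close>.

  \<^item> Conversely, separability provides for each \<open>x \<in> K\<close> a sequence \<open>y\<^sub>n\<close> in \<open>B\<close> with
    \<open>Q\<^bsub>y\<^sub>n\<^esub> \<rightarrow> Q\<^sub>x\<close> at a geometric rate on a dense sequence.  The composition rule turns the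
    infimum of the tail from \<open>n\<close> into a limit of products of the \<open>Q\<^bsub>y\<^sub>m\<^esub>\<close>, \<open>m \<ge> n\<close>, and the
    geometric rate makes the products of these almost-identities on the range of \<open>Q\<^sub>x\<close> stay close
    to the identity there.  So \<open>x\<close> is the lower limit of the \<open>y\<^sub>n\<close>
    (\<open>strong_closure_subset_Cl\<close>).

  The estimates are carried out for the \<open>L\<^sub>1\<close> distance, for which conditional expectations are
  contractions on all integrable functions; \<open>L\<^sub>2\<close> enters only in the convergence along
  decreasing sequences and through the separability hypothesis.\<close>

section \<open>The \<open>L\<^sub>1\<close> distance and conditional expectations\<close>

definition cexp :: "'a measure \<Rightarrow> 'a set set \<Rightarrow> ('a \<Rightarrow> real) \<Rightarrow> 'a \<Rightarrow> real" where
  "cexp M z f = real_cond_exp M (sigma (space M) z) f"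

text \<open>A pseudometric on functions rather than a metric on their classes: distance \<open>0\<close> takes the place
  of almost sure equality, so that identities and estimates can be combined in one calculation.\<close>
definition dist1 :: "'a measure \<Rightarrow> ('a \<Rightarrow> real) \<Rightarrow> ('a \<Rightarrow> real) \<Rightarrow> real" where
  "dist1 M f g = (\<integral>\<omega>. \<bar>f \<omega> - g \<omega>\<bar> \<partial>M)"

lemma dist1_nonneg: "0 \<le> dist1 M f g"
  by (simp add: dist1_def)

lemma dist1_commute: "dist1 M f g = dist1 M g f"
  by (simp add: dist1_def abs_minus_commute)

lemma dist1_self: "dist1 M f f = 0"
  by (simp add: dist1_def)

lemma dist1_triangle:
  assumes "integrable M f" "integrable M g" "integrable M h"
  shows "dist1 M f h \<le> dist1 M f g + dist1 M g h"
proof -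
  have "dist1 M f h \<le> (\<integral>\<omega>. \<bar>f \<omega> - g \<omega>\<bar> + \<bar>g \<omega> - h \<omega>\<bar> \<partial>M)"
    unfolding dist1_def using assms by (intro integral_mono) auto
  also have "\<dots> = dist1 M f g + dist1 M g h"
    unfolding dist1_def using assms by (intro Bochner_Integration.integral_add) auto
  finally show ?thesis .
qed

lemma dist1_eq_0_iff:
  assumes "integrable M f" "integrable M g"
  shows "dist1 M f g = 0 \<longleftrightarrow> (AE \<omega> in M. f \<omega> = g \<omega>)"
  unfolding dist1_def using assms by (subst integral_nonneg_eq_0_iff_AE) auto

lemma dist1_eq_left:
  assumes "integrable M f" "integrable M g" "integrable M h" "dist1 M f g = 0"
  shows "dist1 M f h = dist1 M g h"
  using dist1_triangle[of M f g h] dist1_triangle[of M g f h] assms by (simp add: dist1_commute)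

lemma dist1_eq_right:
  assumes "integrable M f" "integrable M g" "integrable M h" "dist1 M f g = 0"
  shows "dist1 M h f = dist1 M h g"
  using dist1_eq_left[OF assms] by (simp add: dist1_commute)

lemma dist1_eq_0I:
  assumes "\<And>e. e > 0 \<Longrightarrow> dist1 M f g \<le> e"
  shows "dist1 M f g = 0"
  using assms dist1_nonneg[of M f g] by (metis field_le_epsilon add_0 order_antisym)

lemma tendsto_0_less:
  fixes X :: "nat \<Rightarrow> real"
  assumes "X \<longlonglongrightarrow> 0" "e > 0"
  obtains n where "X n < e"
  using eventually_happens[OF order_tendstoD(2)[OF assms]] by auto

lemma space_sigma_field [simp]: "space (sigma (space M) z) = space M"
  by (simp add: space_measure_of_conv)

lemma sets_sigma_field: "z \<in> sigma_fields M \<Longrightarrow> sets (sigma (space M) z) = z"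
  by (simp add: sigma_fields_def sigma_algebra.sets_measure_of_eq)

lemma subalgebra_sigma_field: "z \<in> sigma_fields M \<Longrightarrow> subalgebra M (sigma (space M) z)"
  using sets_sigma_field[of z M] by (auto simp: subalgebra_def sigma_fields_def)

lemma subalgebra_sigma_field_mono:
  "w \<in> sigma_fields M \<Longrightarrow> z \<in> sigma_fields M \<Longrightarrow> w \<subseteq> z \<Longrightarrow>
    subalgebra (sigma (space M) z) (sigma (space M) w)"
  by (simp add: subalgebra_def sets_sigma_field)

lemma borel_measurable_sigma_field_iff:
  "z \<in> sigma_fields M \<Longrightarrow> f \<in> borel_measurable (sigma (space M) z) \<longleftrightarrow>
    (\<forall>S\<in>sets borel. f -` S \<inter> space M \<in> z)" for f :: "'a \<Rightarrow> real"
  by (simp add: measurable_def sets_sigma_field)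

lemma indicator_measurable_sigma_field_iff:
  assumes "z \<in> sigma_fields M" "A \<in> sets M"
  shows "(indicator A :: _ \<Rightarrow> real) \<in> borel_measurable (sigma (space M) z) \<longleftrightarrow> A \<in> z"
  using assms sets.sets_into_space[of A M]
  by (simp add: borel_measurable_indicator_iff sets_sigma_field Int_absorb2)

lemma Int_in_sigma_fields:
  assumes "x \<in> sigma_fields M" "y \<in> sigma_fields M"
  shows "x \<inter> y \<in> sigma_fields M"
proof -
  have "sf_Inf M {x, y} = x \<inter> y"
    using assms by (auto simp: sf_Inf_def sigma_fields_def)
  then show ?thesis
    using sf_Inf_greatest_lower_bound(1)[of "{x, y}" M] assms by simp
qed

context prob_space
begin

lemma sigma_finite_sigma_field:
  "z \<in> sigma_fields M \<Longrightarrow> sigma_finite_subalgebra M (sigma (space M) z)"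
  by (intro finite_measure_subalgebra_is_sigma_finite finite_measure_subalgebra.intro
      finite_measure_subalgebra_axioms.intro subalgebra_sigma_field finite_measure_axioms)

lemma integrable_indicator_event: "A \<in> events \<Longrightarrow> integrable M (indicator A :: 'a \<Rightarrow> real)"
  by (intro integrable_real_indicator) (auto simp: emeasure_eq_measure)

lemma integrable_cexp:
  "z \<in> sigma_fields M \<Longrightarrow> integrable M f \<Longrightarrow> integrable M (cexp M z f)"
  unfolding cexp_def by (rule sigma_finite_subalgebra.real_cond_exp_int[OF sigma_finite_sigma_field])

lemma measurable_cexp: "cexp M z f \<in> borel_measurable (sigma (space M) z)"
  unfolding cexp_def by simp

lemma dist1_cexp_le:
  assumes z: "z \<in> sigma_fields M" and f: "integrable M f" and g: "integrable M g"
  shows "dist1 M (cexp M z f) (cexp M z g) \<le> dist1 M f g"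
proof -
  interpret S: sigma_finite_subalgebra M "sigma (space M) z"
    using z by (rule sigma_finite_sigma_field)
  let ?Q = "real_cond_exp M (sigma (space M) z)"
  have fg: "integrable M (\<lambda>x. f x - g x)" "integrable M (\<lambda>x. \<bar>f x - g x\<bar>)"
    "integrable M (\<lambda>x. - \<bar>f x - g x\<bar>)" "integrable M (\<lambda>x. g x - f x)"
    using f g by auto
  have 1: "AE x in M. ?Q (\<lambda>x. f x - g x) x \<le> ?Q (\<lambda>x. \<bar>f x - g x\<bar>) x"
    using fg by (intro S.real_cond_exp_mono) auto
  have 2: "AE x in M. ?Q (\<lambda>x. g x - f x) x \<le> ?Q (\<lambda>x. \<bar>f x - g x\<bar>) x"
    using fg by (intro S.real_cond_exp_mono) auto
  have "AE x in M. \<bar>?Q f x - ?Q g x\<bar> \<le> ?Q (\<lambda>x. \<bar>f x - g x\<bar>) x"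
    using 1 2 S.real_cond_exp_diff[OF f g] S.real_cond_exp_diff[OF g f] by eventually_elim auto
  then have "dist1 M (cexp M z f) (cexp M z g) \<le> (\<integral>x. ?Q (\<lambda>x. \<bar>f x - g x\<bar>) x \<partial>M)"
    unfolding dist1_def cexp_def
    using f g fg S.real_cond_exp_int(1) by (intro integral_mono_AE) auto
  also have "\<dots> = dist1 M f g"
    unfolding dist1_def using fg by (intro S.real_cond_exp_int(2))
  finally show ?thesis .
qed

text \<open>A function that agrees almost surely with a \<open>z\<close>-measurable one is itself \<open>z\<close>-measurable because
  the \<open>\<sigma>\<close>-fields contain all null sets.  Membership of an event in \<open>z\<close> is thereby expressed by
  the operator: it means that the indicator is a fixed point.\<close>
lemma cexp_fixed_iff:
  assumes z: "z \<in> sigma_fields M" and f: "integrable M f"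
  shows "dist1 M (cexp M z f) f = 0 \<longleftrightarrow> f \<in> borel_measurable (sigma (space M) z)"
proof
  interpret S: sigma_finite_subalgebra M "sigma (space M) z"
    using z by (rule sigma_finite_sigma_field)
  show "dist1 M (cexp M z f) f = 0" if "f \<in> borel_measurable (sigma (space M) z)"
    using that f S.real_cond_exp_F_meas[OF f that] integrable_cexp[OF z f]
    by (subst dist1_eq_0_iff) (auto simp: cexp_def)
  assume "dist1 M (cexp M z f) f = 0"
  then have ae: "AE x in M. cexp M z f x = f x"
    using integrable_cexp[OF z f] f by (simp add: dist1_eq_0_iff)
  show "f \<in> borel_measurable (sigma (space M) z)"
    unfolding borel_measurable_sigma_field_iff[OF z]
  proof
    fix S :: "real set" assume S: "S \<in> sets borel"
    let ?A = "f -` S \<inter> space M" and ?C = "cexp M z f -` S \<inter> space M"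
    have C: "?C \<in> z"
      using measurable_cexp[of z f] S by (simp add: borel_measurable_sigma_field_iff[OF z])
    have A: "?A \<in> sets M"
      using f S by (auto intro: measurable_sets)
    have CM: "?C \<in> sets M"
      using C z by (auto simp: sigma_fields_def)
    have "?A - ?C \<in> null_sets M" "?C - ?A \<in> null_sets M"
      using ae A CM by (auto simp: AE_iff_null_sets[symmetric] sets.Diff
          intro!: AE_iff_null_sets[THEN iffD2] elim!: eventually_mono)
    moreover interpret Z: sigma_algebra "space M" z
      using z by (simp add: sigma_fields_def)
    have "?A = (?C - (?C - ?A)) \<union> (?A - ?C)"
      by auto
    ultimately show "?A \<in> z"
      using C z by (metis (no_types, lifting) Z.Diff Z.Un sigma_fields_def mem_Collect_eq subsetD)
  qed
qed

lemma dist1_cexp_cong: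
  assumes "z \<in> sigma_fields M" "integrable M f" "integrable M g" "dist1 M f g = 0"
  shows "dist1 M (cexp M z f) (cexp M z g) = 0"
  using dist1_cexp_le[OF assms(1-3)] assms(4) dist1_nonneg[of M "cexp M z f" "cexp M z g"] by simp

lemma cexp_tower:
  assumes "w \<in> sigma_fields M" "z \<in> sigma_fields M" "w \<subseteq> z" "integrable M f"
  shows "dist1 M (cexp M w (cexp M z f)) (cexp M w f) = 0"
proof -
  interpret S: sigma_finite_subalgebra M "sigma (space M) w"
    using assms by (intro sigma_finite_sigma_field)
  show ?thesis
    using S.real_cond_exp_nested_subalg[OF subalgebra_sigma_field[OF assms(2)]
        subalgebra_sigma_field_mono[OF assms(1-3)] assms(4)] assms
    by (subst dist1_eq_0_iff) (auto simp: cexp_def[symmetric] intro!: integrable_cexp)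
qed

lemma cexp_absorb:
  assumes "w \<in> sigma_fields M" "z \<in> sigma_fields M" "w \<subseteq> z" "integrable M f"
  shows "dist1 M (cexp M z (cexp M w f)) (cexp M w f) = 0"
  using measurable_cexp[of w f] assms
  by (subst cexp_fixed_iff)
    (auto simp: borel_measurable_sigma_field_iff integrable_cexp subset_iff)

text \<open>The standard machine with the pointwise limit step replaced by an \<open>L\<^sub>1\<close> limit, which is what
  contractions preserve.\<close>
lemma integrable_sigma_field_induct [consumes 3, case_names indicator add scale limit]:
  assumes z: "z \<in> sigma_fields M" and f: "integrable M f" "f \<in> borel_measurable (sigma (space M) z)"
    and ind: "\<And>A. A \<in> z \<Longrightarrow> P (indicator A)"
    and add: "\<And>f g. integrable M f \<Longrightarrow> integrable M g \<Longrightarrow> P f \<Longrightarrow> P g \<Longrightarrow> P (\<lambda>x. f x + g x)"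
    and scale: "\<And>f c. integrable M f \<Longrightarrow> P f \<Longrightarrow> P (\<lambda>x. c * f x)"
    and limit: "\<And>f. integrable M f \<Longrightarrow>
      (\<And>e. e > 0 \<Longrightarrow> \<exists>g. integrable M g \<and> P g \<and> dist1 M f g < e) \<Longrightarrow> P f"
  shows "P f"
proof -
  let ?N = "restr_to_subalg M (sigma (space M) z)"
  note sub = subalgebra_sigma_field[OF z]
  have sets_N: "sets ?N = z"
    using sub z by (simp add: sets_restr_to_subalg sets_sigma_field)
  have "integrable ?N f"
    using sub f by (intro integrable_in_subalg)
  then show ?thesis
  proof (induction rule: integrable_induct)
    case (base A c)
    then have "A \<in> z" by (simp add: sets_N)
    moreover from this have "integrable M (indicator A :: _ \<Rightarrow> real)"
      using z by (intro integrable_real_indicator) (auto simp: sigma_fields_def emeasure_eq_measure)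
    ultimately show ?case
      using scale[OF _ ind[of A], of c] by (simp add: mult.commute)
  next
    case (add f g)
    then show ?case
      by (intro assms(5)) (auto intro: integrable_from_subalg[OF sub])
  next
    case (lim f s)
    have s: "integrable M (s i)" for i
      using lim by (auto intro: integrable_from_subalg[OF sub])
    have f: "integrable M f"
      using lim by (auto intro: integrable_from_subalg[OF sub])
    have "(\<lambda>i. \<integral>x. \<bar>f x - s i x\<bar> \<partial>M) \<longlonglongrightarrow> (\<integral>x. 0 \<partial>M)"
    proof (rule integral_dominated_convergence[where w = "\<lambda>x. 3 * \<bar>f x\<bar>"])
      show "AE x in M. (\<lambda>i. \<bar>f x - s i x\<bar>) \<longlonglongrightarrow> 0"
      proof (rule AE_I2)
        fix x assume "x \<in> space M"
        then have "(\<lambda>i. s i x) \<longlonglongrightarrow> f x"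
          using lim by (auto simp: space_restr_to_subalg)
        from tendsto_rabs[OF tendsto_diff[OF tendsto_const[of "f x"] this]]
        show "(\<lambda>i. \<bar>f x - s i x\<bar>) \<longlonglongrightarrow> 0" by simp
      qed
      show "AE x in M. norm \<bar>f x - s i x\<bar> \<le> 3 * \<bar>f x\<bar>" for i
      proof (rule AE_I2)
        fix x assume "x \<in> space M"
        then have "\<bar>s i x\<bar> \<le> 2 * \<bar>f x\<bar>"
          using lim by (auto simp: space_restr_to_subalg)
        then show "norm \<bar>f x - s i x\<bar> \<le> 3 * \<bar>f x\<bar>" by simp
      qed
    qed (use s f in auto)
    then have "(\<lambda>i. dist1 M f (s i)) \<longlonglongrightarrow> 0"
      by (simp add: dist1_def)
    then have "\<exists>i. dist1 M f (s i) < e" if "e > 0" for e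
      using that by (rule tendsto_0_less) blast
    then have ex: "\<exists>g. integrable M g \<and> P g \<and> dist1 M f g < e" if "e > 0" for e
      using lim.IH s that by blast
    show ?case
      by (rule limit[OF f ex])
  qed
qed

end

section \<open>Convergence of conditional expectations\<close>

definition cexp_converges :: "'a measure \<Rightarrow> (nat \<Rightarrow> 'a set set) \<Rightarrow> 'a set set \<Rightarrow> ('a \<Rightarrow> real) \<Rightarrow> bool" where
  "cexp_converges M z w f \<longleftrightarrow> (\<lambda>n. dist1 M (cexp M (z n) f) (cexp M w f)) \<longlonglongrightarrow> 0"

context prob_space
begin

lemma dist1_cexp_add:
  assumes z: "z \<in> sigma_fields M" and w: "w \<in> sigma_fields M"
    and f: "integrable M f" and g: "integrable M g"
  shows "dist1 M (cexp M z (\<lambda>x. f x + g x)) (cexp M w (\<lambda>x. f x + g x))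
    \<le> dist1 M (cexp M z f) (cexp M w f) + dist1 M (cexp M z g) (cexp M w g)"
proof -
  note int = integrable_cexp[OF z] integrable_cexp[OF w]
  have "AE x in M. cexp M z (\<lambda>x. f x + g x) x = cexp M z f x + cexp M z g x"
    unfolding cexp_def using f g
    by (rule sigma_finite_subalgebra.real_cond_exp_add[OF sigma_finite_sigma_field[OF z]])
  moreover have "AE x in M. cexp M w (\<lambda>x. f x + g x) x = cexp M w f x + cexp M w g x"
    unfolding cexp_def using f g
    by (rule sigma_finite_subalgebra.real_cond_exp_add[OF sigma_finite_sigma_field[OF w]])
  ultimately have "AE x in M. \<bar>cexp M z (\<lambda>x. f x + g x) x - cexp M w (\<lambda>x. f x + g x) x\<bar>
      \<le> \<bar>cexp M z f x - cexp M w f x\<bar> + \<bar>cexp M z g x - cexp M w g x\<bar>"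
    by eventually_elim linarith
  then have "dist1 M (cexp M z (\<lambda>x. f x + g x)) (cexp M w (\<lambda>x. f x + g x))
    \<le> (\<integral>x. \<bar>cexp M z f x - cexp M w f x\<bar> + \<bar>cexp M z g x - cexp M w g x\<bar> \<partial>M)"
    unfolding dist1_def using f g
    by (intro integral_mono_AE integrable_abs Bochner_Integration.integrable_add
        Bochner_Integration.integrable_diff int) auto
  also have "\<dots> = dist1 M (cexp M z f) (cexp M w f) + dist1 M (cexp M z g) (cexp M w g)"
    unfolding dist1_def using f g
    by (intro Bochner_Integration.integral_add integrable_abs Bochner_Integration.integrable_diff int)
  finally show ?thesis .
qed

lemma dist1_cexp_scale:
  assumes z: "z \<in> sigma_fields M" and w: "w \<in> sigma_fields M" and f: "integrable M f"
  shows "dist1 M (cexp M z (\<lambda>x. c * f x)) (cexp M w (\<lambda>x. c * f x))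
    = \<bar>c\<bar> * dist1 M (cexp M z f) (cexp M w f)"
proof -
  have "AE x in M. cexp M z (\<lambda>x. c * f x) x = c * cexp M z f x"
    unfolding cexp_def using f
    by (rule sigma_finite_subalgebra.real_cond_exp_cmult[OF sigma_finite_sigma_field[OF z]])
  moreover have "AE x in M. cexp M w (\<lambda>x. c * f x) x = c * cexp M w f x"
    unfolding cexp_def using f
    by (rule sigma_finite_subalgebra.real_cond_exp_cmult[OF sigma_finite_sigma_field[OF w]])
  ultimately have "AE x in M. \<bar>cexp M z (\<lambda>x. c * f x) x - cexp M w (\<lambda>x. c * f x) x\<bar>
      = \<bar>c\<bar> * \<bar>cexp M z f x - cexp M w f x\<bar>"
    by eventually_elim (simp add: abs_mult[symmetric] algebra_simps)
  then have "dist1 M (cexp M z (\<lambda>x. c * f x)) (cexp M w (\<lambda>x. c * f x))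
    = (\<integral>x. \<bar>c\<bar> * \<bar>cexp M z f x - cexp M w f x\<bar> \<partial>M)"
    unfolding dist1_def
    using integrable_cexp[OF z] integrable_cexp[OF w] f by (intro integral_cong_AE) auto
  then show ?thesis
    by (simp add: dist1_def)
qed

lemma dist1_cexp_approx:
  assumes z: "z \<in> sigma_fields M" and w: "w \<in> sigma_fields M"
    and f: "integrable M f" and g: "integrable M g"
  shows "dist1 M (cexp M z f) (cexp M w f) \<le> 2 * dist1 M f g + dist1 M (cexp M z g) (cexp M w g)"
proof -
  note int = integrable_cexp[OF z] integrable_cexp[OF w]
  have "dist1 M (cexp M z f) (cexp M w f) \<le> dist1 M (cexp M z f) (cexp M z g) + dist1 M (cexp M z g) (cexp M w f)"
    using f g by (intro dist1_triangle int)
  moreover have "dist1 M (cexp M z g) (cexp M w f) \<le> dist1 M (cexp M z g) (cexp M w g) + dist1 M (cexp M w f) (cexp M w g)"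
    using f g dist1_commute[of M "cexp M w f"] by (metis dist1_triangle int)
  ultimately show ?thesis
    using dist1_cexp_le[OF z f g] dist1_cexp_le[OF w f g] by simp
qed

context
  fixes z :: "nat \<Rightarrow> 'a set set" and w
  assumes z: "\<And>n. z n \<in> sigma_fields M" and w: "w \<in> sigma_fields M"
begin

lemma cexp_converges_add:
  assumes "integrable M f" "integrable M g" "cexp_converges M z w f" "cexp_converges M z w g"
  shows "cexp_converges M z w (\<lambda>x. f x + g x)"
  unfolding cexp_converges_def
proof (rule tendsto_sandwich[where f = "\<lambda>_. 0"])
  show "(\<lambda>n. dist1 M (cexp M (z n) f) (cexp M w f) + dist1 M (cexp M (z n) g) (cexp M w g)) \<longlonglongrightarrow> 0"
    using tendsto_add[OF assms(3,4)[unfolded cexp_converges_def]] by simp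
qed (auto simp: dist1_nonneg dist1_cexp_add[OF z w assms(1,2)])

lemma cexp_converges_scale:
  assumes "integrable M f" "cexp_converges M z w f"
  shows "cexp_converges M z w (\<lambda>x. c * f x)"
  using tendsto_mult_left[OF assms(2)[unfolded cexp_converges_def], of "\<bar>c\<bar>"]
  by (simp add: cexp_converges_def dist1_cexp_scale[OF z w assms(1)])

lemma cexp_converges_limit:
  assumes f: "integrable M f"
    and ap: "\<And>e. e > 0 \<Longrightarrow> \<exists>g. integrable M g \<and> cexp_converges M z w g \<and> dist1 M f g < e"
  shows "cexp_converges M z w f"
  unfolding cexp_converges_def
proof (rule order_tendstoI)
  fix e :: real assume e: "0 < e"
  then obtain g where g: "integrable M g" "cexp_converges M z w g" "dist1 M f g < e / 4"
    using ap[of "e / 4"] by auto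
  have "\<forall>\<^sub>F n in sequentially. dist1 M (cexp M (z n) g) (cexp M w g) < e / 2"
    using g(2) e unfolding cexp_converges_def by (intro order_tendstoD(2)) auto
  then show "\<forall>\<^sub>F n in sequentially. dist1 M (cexp M (z n) f) (cexp M w f) < e"
  proof eventually_elim
    case (elim n)
    then show ?case
      using dist1_cexp_approx[OF z w f g(1), of n] g(3) by linarith
  qed
next
  fix e :: real assume "e < 0"
  then show "\<forall>\<^sub>F n in sequentially. e < dist1 M (cexp M (z n) f) (cexp M w f)"
    by (simp add: less_le_trans[OF _ dist1_nonneg])
qed

lemma cexp_converges_if_indicators:
  assumes u: "u \<in> sigma_fields M"
    and ind: "\<And>A. A \<in> u \<Longrightarrow> cexp_converges M z w (indicator A)"
    and f: "integrable M f" "f \<in> borel_measurable (sigma (space M) u)"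
  shows "cexp_converges M z w f"
  using u f
proof (induction rule: integrable_sigma_field_induct)
  case (indicator A)
  then show ?case by (rule ind)
next
  case (add f g)
  then show ?case by (rule cexp_converges_add)
next
  case (scale f c)
  then show ?case by (rule cexp_converges_scale)
next
  case (limit f)
  then show ?case by (rule cexp_converges_limit)
qed

lemma cexp_convergesI:
  assumes f: "integrable M f"
    and "\<And>e. e > 0 \<Longrightarrow> \<exists>N. \<forall>n\<ge>N. dist1 M (cexp M (z n) f) (cexp M w f) \<le> e"
  shows "cexp_converges M z w f"
  unfolding cexp_converges_def
proof (rule LIMSEQ_I)
  fix e :: real assume "0 < e"
  then obtain N where "\<And>n. n \<ge> N \<Longrightarrow> dist1 M (cexp M (z n) f) (cexp M w f) \<le> e / 2"
    using assms(2)[OF half_gt_zero] by blast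
  then have "\<And>n. n \<ge> N \<Longrightarrow> norm (dist1 M (cexp M (z n) f) (cexp M w f) - 0) < e"
    using \<open>0 < e\<close> by (fastforce simp: dist1_nonneg)
  then show "\<exists>N. \<forall>n\<ge>N. norm (dist1 M (cexp M (z n) f) (cexp M w f) - 0) < e"
    by blast
qed

end

text \<open>The variance of \<open>\<bar>f - g\<bar>\<close> is nonnegative.\<close>
lemma dist1_le_L2:
  assumes "integrable M f" "integrable M g" "integrable M (\<lambda>x. (f x - g x)\<^sup>2)"
  shows "(dist1 M f g)\<^sup>2 \<le> (\<integral>x. (f x - g x)\<^sup>2 \<partial>M)"
proof -
  have "0 \<le> variance (\<lambda>x. \<bar>f x - g x\<bar>)"
    by (rule variance_positive)
  also have "\<dots> = expectation (\<lambda>x. \<bar>f x - g x\<bar>\<^sup>2) - (expectation (\<lambda>x. \<bar>f x - g x\<bar>))\<^sup>2"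
    using assms by (intro variance_eq) auto
  finally show ?thesis
    by (simp add: dist1_def)
qed

text \<open>For an indicator \<open>f\<close>, the functions \<open>g\<^sub>n = Q\<^bsub>z\<^sub>n\<^esub> f\<close> are bounded and are successive orthogonal
  projections of each other, so \<open>\<parallel>g\<^sub>n - g\<^sub>m\<parallel>\<^sup>2 = \<parallel>g\<^sub>n\<parallel>\<^sup>2 - \<parallel>g\<^sub>m\<parallel>\<^sup>2\<close> in \<open>L\<^sub>2\<close> for \<open>n \<le> m\<close> and the sequence is
  Cauchy.  An almost sure limit \<open>h\<close> of a subsequence depends only on tails, hence is measurable
  for every \<open>z\<^sub>n\<close> and so for the infimum \<open>w\<close>; being a limit of the \<open>g\<^sub>n\<close> it must be \<open>Q\<^sub>w f\<close>.\<close>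
lemma cexp_converges_decreasing:
  assumes z: "\<And>n. z n \<in> sigma_fields M" and dec: "decseq z" and f: "integrable M f"
  shows "cexp_converges M z (sf_Inf M (range z)) f"
proof -
  define w where "w = sf_Inf M (range z)"
  have w: "w \<in> sigma_fields M" and w_le: "w \<subseteq> z n" for n
    unfolding w_def using z sf_Inf_greatest_lower_bound[of "range z" M] by blast+
  have ind: "cexp_converges M z w (indicator A)" if A: "A \<in> sets M" for A
  proof -
    let ?f = "indicator A :: 'a \<Rightarrow> real"
    define g where "g n = cexp M (z n) ?f" for n
    have f: "integrable M ?f"
      using A by (intro integrable_real_indicator) (auto simp: emeasure_eq_measure)
    have gi: "integrable M (g n)" for n
      unfolding g_def by (intro integrable_cexp z f)
    have gm: "g n \<in> borel_measurable (sigma (space M) (z n))" for n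
      unfolding g_def by (rule measurable_cexp)
    have gb: "AE x in M. \<bar>g n x\<bar> \<le> 1" for n
    proof -
      interpret S: sigma_finite_subalgebra M "sigma (space M) (z n)"
        using z by (rule sigma_finite_sigma_field)
      have "AE x in M. g n x \<ge> 0" "AE x in M. g n x \<le> 1"
        unfolding g_def cexp_def using f
        by (auto intro!: S.real_cond_exp_ge_c S.real_cond_exp_le_c simp: indicator_def)
      then show ?thesis by eventually_elim auto
    qed
    have gtower: "dist1 M (cexp M (z m) (g n)) (g m) = 0" if "n \<le> m" for n m
      unfolding g_def using decseqD[OF dec that] by (intro cexp_tower z f)
    have ggi: "integrable M (\<lambda>x. g n x * g m x)" for n m
    proof (rule integrable_const_bound)
      show "AE x in M. norm (g n x * g m x) \<le> 1"
        using gb[of n] gb[of m]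
        by eventually_elim (simp add: abs_mult mult_le_one)
    qed (use gi in auto)
    define a where "a n = (\<integral>x. g n x * g n x \<partial>M)" for n
    have cross: "(\<integral>x. g m x * g n x \<partial>M) = a m" if "n \<le> m" for n m
    proof -
      interpret S: sigma_finite_subalgebra M "sigma (space M) (z m)"
        using z by (rule sigma_finite_sigma_field)
      have "(\<integral>x. g m x * g n x \<partial>M) = (\<integral>x. g m x * cexp M (z m) (g n) x \<partial>M)"
        unfolding cexp_def using gi
        by (intro S.real_cond_exp_intg(2)[symmetric] ggi gm) auto
      also have "\<dots> = a m"
        unfolding a_def
      proof (rule integral_cong_AE)
        show "AE x in M. g m x * cexp M (z m) (g n) x = g m x * g m x"
          using gtower[OF that] gi by (subst (asm) dist1_eq_0_iff) (auto intro: integrable_cexp z)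
      qed (use gi integrable_cexp[OF z gi] in auto)
      finally show ?thesis .
    qed
    have sq: "(\<lambda>x. (g n x - g m x)\<^sup>2) = (\<lambda>x. g n x * g n x - 2 * (g m x * g n x) + g m x * g m x)" for n m
      by (auto simp: power2_eq_square algebra_simps)
    have L2: "(\<integral>x. (g n x - g m x)\<^sup>2 \<partial>M) = a n - a m" if "n \<le> m" for n m
      unfolding sq using ggi cross[OF that] by (simp add: a_def)
    have dist_a: "(dist1 M (g n) (g m))\<^sup>2 \<le> a n - a m" if "n \<le> m" for n m
    proof -
      have "integrable M (\<lambda>x. (g n x - g m x)\<^sup>2)"
        unfolding sq using ggi by simp
      then show ?thesis
        using dist1_le_L2[OF gi gi, of n m] L2[OF that] by simp
    qed
    have "decseq a"
      using dist_a by (intro decseq_SucI) (smt (verit) le_add2 plus_1_eq_Suc zero_le_power2)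
    moreover have "0 \<le> a n" for n
      unfolding a_def by simp
    ultimately obtain L where L: "a \<longlonglongrightarrow> L"
      using decseq_convergent by metis
    have "\<exists>N. \<forall>i\<ge>N. \<forall>j\<ge>N. (\<integral>x. norm (g i x - g j x) \<partial>M) < e" if e: "e > 0" for e
    proof -
      obtain N where N: "\<bar>a i - a j\<bar> < e\<^sup>2" if "i \<ge> N" "j \<ge> N" for i j
        using LIMSEQ_imp_Cauchy[OF L] e unfolding Cauchy_def dist_real_def by (metis zero_less_power)
      have "dist1 M (g i) (g j) < e" if "i \<ge> N" "j \<ge> N" for i j
      proof -
        have "(dist1 M (g i) (g j))\<^sup>2 \<le> \<bar>a i - a j\<bar>"
          using dist_a[of i j] dist_a[of j i] dist1_commute[of M "g i" "g j"] by (cases "i \<le> j") auto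
        then have "(dist1 M (g i) (g j))\<^sup>2 < e\<^sup>2"
          using N[OF that] by simp
        then show ?thesis
          using e by (simp add: power_less_imp_less_base)
      qed
      then show ?thesis by (auto simp: dist1_def)
    qed
    with gi obtain r where r: "strict_mono r" "AE x in M. Cauchy (\<lambda>i. g (r i) x)"
      by (rule cauchy_L1_AE_cauchy_subseq)
    \<comment> \<open>\<open>lim\<close> is an arbitrary but fixed value off the convergence set, so it too ignores initial segments\<close>
    define h where "h x = lim (\<lambda>i. g (r i) x)" for x
    have lim: "AE x in M. (\<lambda>i. g (r i) x) \<longlonglongrightarrow> h x"
      using r(2) by eventually_elim (simp add: h_def Cauchy_convergent_iff convergent_LIMSEQ_iff)
    have hm: "h \<in> borel_measurable (sigma (space M) (z n))" for n
    proof -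
      have "(\<lambda>i. g (r i) x) \<longlonglongrightarrow> L \<longleftrightarrow> (\<lambda>i. g (r (i + n)) x) \<longlonglongrightarrow> L" for x L
        using LIMSEQ_ignore_initial_segment[of "\<lambda>i. g (r i) x" L n]
          LIMSEQ_offset[of "\<lambda>i. g (r i) x" n L] by blast
      then have "h = (\<lambda>x. lim (\<lambda>i. g (r (i + n)) x))"
        by (simp add: h_def lim_def fun_eq_iff)
      moreover have "g (r (i + n)) \<in> borel_measurable (sigma (space M) (z n))" for i
      proof -
        have "n \<le> r (i + n)"
          using seq_suble[OF r(1), of "i + n"] by simp
        then show ?thesis
          using gm[of "r (i + n)"] decseqD[OF dec] z by (auto simp: borel_measurable_sigma_field_iff)
      qed
      ultimately show ?thesis
        by (simp add: borel_measurable_lim_metric)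
    qed
    have hM: "h \<in> borel_measurable M"
      using hm[of 0] by (rule measurable_from_subalg[OF subalgebra_sigma_field[OF z]])
    have hw: "h \<in> borel_measurable (sigma (space M) w)"
      using hm hM measurable_sets[OF hM] z w
      by (auto simp: borel_measurable_sigma_field_iff w_def sf_Inf_def)
    have gb': "AE x in M. \<forall>i. \<bar>g (r i) x\<bar> \<le> 1"
      using gb by (simp add: AE_all_countable)
    have hb: "AE x in M. \<bar>h x\<bar> \<le> 1"
      using lim gb'
      by eventually_elim (metis LIMSEQ_le_const2 tendsto_rabs)
    have hi: "integrable M h"
      using hb hM by (intro integrable_const_bound[of _ 1]) auto
    have "(\<lambda>i. \<integral>x. \<bar>g (r i) x - h x\<bar> \<partial>M) \<longlonglongrightarrow> (\<integral>x. 0 \<partial>M)"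
    proof (rule integral_dominated_convergence[where w = "\<lambda>_. 2"])
      show "AE x in M. (\<lambda>i. \<bar>g (r i) x - h x\<bar>) \<longlonglongrightarrow> 0"
        using lim by eventually_elim (simp add: LIM_zero_iff tendsto_rabs_zero_iff)
      show "AE x in M. norm \<bar>g (r i) x - h x\<bar> \<le> 2" for i
        using gb' hb
      proof eventually_elim
        case (elim x)
        then have "\<bar>g (r i) x\<bar> \<le> 1" by blast
        then show ?case using elim(2) by simp
      qed
    qed (use gi hi in auto)
    then have conv: "(\<lambda>i. dist1 M (g (r i)) h) \<longlonglongrightarrow> 0"
      by (simp add: dist1_def)
    have h_fix: "dist1 M (cexp M (z n) h) h = 0" for n
      using cexp_fixed_iff[OF z hi] hm by blast
    have h_fix_w: "dist1 M (cexp M w h) h = 0"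
      using cexp_fixed_iff[OF w hi] hw by blast
    have h_eq: "dist1 M (cexp M w ?f) h = 0"
    proof (rule dist1_eq_0I)
      fix e :: real assume "e > 0"
      then obtain i where i: "dist1 M (g (r i)) h < e"
        using tendsto_0_less[OF conv] by blast
      have "dist1 M (cexp M w ?f) h = dist1 M (cexp M w (g (r i))) h"
        unfolding g_def
        by (intro dist1_eq_left[symmetric] cexp_tower integrable_cexp w z w_le f hi)
      also have "\<dots> = dist1 M (cexp M w (g (r i))) (cexp M w h)"
        by (intro dist1_eq_right[symmetric] h_fix_w integrable_cexp w gi hi)
      also have "\<dots> \<le> dist1 M (g (r i)) h"
        by (intro dist1_cexp_le w gi hi)
      finally show "dist1 M (cexp M w ?f) h \<le> e"
        using i by simp
    qed
    show ?thesis
    proof (rule cexp_convergesI[OF z w f])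
      fix e :: real assume "e > 0"
      then obtain i where i: "dist1 M (g (r i)) h < e"
        using tendsto_0_less[OF conv] by blast
      have "dist1 M (g m) (cexp M w ?f) \<le> e" if "m \<ge> r i" for m
      proof -
        have "dist1 M (g m) (cexp M w ?f) = dist1 M (g m) h"
          by (intro dist1_eq_right h_eq integrable_cexp w gi f hi)
        also have "\<dots> = dist1 M (cexp M (z m) (g (r i))) h"
          using gtower[OF that] by (intro dist1_eq_left[symmetric] integrable_cexp z gi hi)
        also have "\<dots> = dist1 M (cexp M (z m) (g (r i))) (cexp M (z m) h)"
          by (intro dist1_eq_right[symmetric] h_fix integrable_cexp z gi hi)
        also have "\<dots> \<le> dist1 M (g (r i)) h"
          by (intro dist1_cexp_le z gi hi)
        finally show ?thesis
          using i by simp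
      qed
      then show "\<exists>N. \<forall>n\<ge>N. dist1 M (cexp M (z n) ?f) (cexp M w ?f) \<le> e"
        unfolding g_def by blast
    qed
  qed
  have top: "sets M \<in> sigma_fields M"
    by (auto simp: sigma_fields_def sets.sigma_algebra_axioms)
  then have fm: "f \<in> borel_measurable (sigma (space M) (sets M))"
    using f by (auto simp: borel_measurable_sigma_field_iff intro: measurable_sets)
  show ?thesis
    unfolding w_def[symmetric] by (rule cexp_converges_if_indicators[OF z w top ind f fm])
qed

text \<open>The sets whose indicators converge form a Dynkin system: complements are handled by linearity,
  and a disjoint union is an \<open>L\<^sub>1\<close> limit of finite sums.  The field \<open>u\<close> may differ from the
  limit \<open>w\<close>: for increasing sequences \<open>u = w\<close>, but the independence argument below uses a larger
  \<open>u\<close>.\<close>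
lemma cexp_converges_if_generator:
  assumes z: "\<And>n. z n \<in> sigma_fields M" and w: "w \<in> sigma_fields M" and u: "u \<in> sigma_fields M"
    and u_eq: "u = sigma_sets (space M) G" and G: "Int_stable G" "space M \<in> G"
    and ind: "\<And>A. A \<in> G \<Longrightarrow> cexp_converges M z w (indicator A)"
    and f: "integrable M f" "f \<in> borel_measurable (sigma (space M) u)"
  shows "cexp_converges M z w f"
proof -
  have uM: "u \<subseteq> sets M"
    using u by (simp add: sigma_fields_def)
  have GM: "G \<subseteq> sets M"
    using uM u_eq by (auto intro: sigma_sets.Basic)
  have zero: "cexp_converges M z w (\<lambda>_. 0)"
    using cexp_converges_scale[OF z w integrable_indicator_event[OF sets.top] ind[OF G(2)], of 0] by simp
  have "cexp_converges M z w (indicator A)" if "A \<in> u" for A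
  proof -
    have "G \<subseteq> Pow (space M)"
      using GM sets.space_closed by blast
    from G(1) this that[unfolded u_eq] show ?thesis
    proof (induction rule: sigma_sets_induct_disjoint)
      case (basic A)
      then show ?case by (rule ind)
    next
      case empty
      show ?case using zero by simp
    next
      case (compl A)
      have A: "A \<in> sets M"
        using compl u_eq uM by auto
      have "cexp_converges M z w (\<lambda>x. indicator (space M) x + (-1) * indicator A x)"
        using A compl by (intro cexp_converges_add cexp_converges_scale z w ind[OF G(2)]) (auto intro!: integrable_indicator_event)
      moreover have "dist1 M (indicator (space M - A)) (\<lambda>x. indicator (space M) x + (-1) * indicator A x) = 0"
        unfolding dist1_def by (intro integral_eq_zero_AE AE_I2) (auto simp: indicator_def)
      ultimately show ?case
        using A by (intro cexp_converges_limit z w)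
          (auto intro!: integrable_indicator_event exI[of _ "\<lambda>x. indicator (space M) x + (-1) * indicator A x"])
    next
      case (union A)
      have A: "A i \<in> sets M" for i
        using union.hyps(2) u_eq uM by auto
      let ?g = "\<lambda>k x. (\<Sum>i<k. indicator (A i) x) :: real"
      have gi: "integrable M (?g k)" for k
        by (intro Bochner_Integration.integrable_sum integrable_indicator_event A)
      have g: "cexp_converges M z w (?g k)" for k
      proof (induction k)
        case 0
        show ?case using zero by simp
      next
        case (Suc k)
        then show ?case
          using union.IH[of k] by (simp, intro cexp_converges_add z w gi integrable_indicator_event A)
      qed
      have sums: "(\<lambda>i. indicator (A i) x :: real) sums indicator (\<Union>i. A i) x" for x
        using union.hyps(1) by (intro indicator_sums) (auto simp: disjoint_family_on_def)
      have le: "?g k x \<le> indicator (\<Union>i. A i) x" for k x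
        using sum_le_suminf[OF sums_summable[OF sums[of x]], of "{..<k}"] sums_unique[OF sums[of x]] by simp
      have "(\<lambda>k. \<integral>x. \<bar>indicator (\<Union>i. A i) x - ?g k x\<bar> \<partial>M) \<longlonglongrightarrow> (\<integral>x. 0 \<partial>M)"
      proof (rule integral_dominated_convergence[where w = "\<lambda>_. 1"])
        show "AE x in M. (\<lambda>k. \<bar>indicator (\<Union>i. A i) x - ?g k x\<bar>) \<longlonglongrightarrow> 0"
        proof (rule AE_I2)
          fix x
          have "(\<lambda>k. ?g k x) \<longlonglongrightarrow> indicator (\<Union>i. A i) x"
            using sums[of x] by (simp add: sums_def)
          from tendsto_rabs[OF tendsto_diff[OF tendsto_const[of "indicator (\<Union>i. A i) x"] this]]
          show "(\<lambda>k. \<bar>indicator (\<Union>i. A i) x - ?g k x\<bar>) \<longlonglongrightarrow> 0" by simp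
        qed
        show "AE x in M. norm \<bar>indicator (\<Union>i. A i) x - ?g k x\<bar> \<le> 1" for k
        proof (rule AE_I2)
          fix x
          have "0 \<le> ?g k x" by (intro sum_nonneg) simp
          moreover have "indicator (\<Union>i. A i) x \<le> (1::real)" by (simp add: indicator_def)
          ultimately show "norm \<bar>indicator (\<Union>i. A i) x - ?g k x\<bar> \<le> 1"
            using le[of x k] unfolding real_norm_def by linarith
        qed
      qed (use gi A in auto)
      then have conv: "(\<lambda>k. dist1 M (indicator (\<Union>i. A i)) (?g k)) \<longlonglongrightarrow> 0"
        by (simp add: dist1_def)
      show ?case
      proof (rule cexp_converges_limit[OF z w])
        show "integrable M (indicator (\<Union>i. A i) :: 'a \<Rightarrow> real)"
          using A by (intro integrable_indicator_event) auto
        fix e :: real assume "e > 0"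
        then obtain k where "dist1 M (indicator (\<Union>i. A i)) (?g k) < e"
          using tendsto_0_less[OF conv] by blast
        with g[of k] gi[of k] show "\<exists>g. integrable M g \<and> cexp_converges M z w g \<and> dist1 M (indicator (\<Union>i. A i)) g < e"
          by blast
      qed
    qed
  qed
  then show ?thesis
    by (rule cexp_converges_if_indicators[OF z w u _ f])
qed

text \<open>An indicator from \<open>z\<^sub>m\<close> is fixed by \<open>Q\<^bsub>z\<^sub>n\<^esub>\<close> from \<open>n = m\<close> on, and the union of the \<open>z\<^sub>m\<close> is a generator of
  the supremum \<open>w\<close> that is stable under intersection.  This settles the functions measurable for the
  supremum, and \<open>Q\<^bsub>z\<^sub>n\<^esub> f = Q\<^bsub>z\<^sub>n\<^esub> Q\<^sub>w f\<close> reduces any \<open>f\<close> to these.\<close>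
lemma cexp_converges_increasing:
  assumes z: "\<And>n. z n \<in> sigma_fields M" and inc: "incseq z" and f: "integrable M f"
  shows "cexp_converges M z (sf_Sup M (range z)) f"
proof -
  define w where "w = sf_Sup M (range z)"
  have w: "w \<in> sigma_fields M" and w_ge: "z n \<subseteq> w" for n
    unfolding w_def using z sf_Sup_least_upper_bound[of "range z" M] by blast+
  have wM: "w \<subseteq> sets M"
    using w by (simp add: sigma_fields_def)
  have zmem: "cexp_converges M z w (indicator A)" if A: "A \<in> z m" for A m
  proof (rule cexp_convergesI[OF z w])
    have "A \<in> sets M"
      using A w_ge wM by blast
    then show i: "integrable M (indicator A :: 'a \<Rightarrow> real)"
      by (rule integrable_indicator_event)
    have fixed: "dist1 M (cexp M u (indicator A)) (indicator A) = 0" if "u \<in> sigma_fields M" "A \<in> u" for u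
      using cexp_fixed_iff[OF that(1) i] indicator_measurable_sigma_field_iff[OF that(1) \<open>A \<in> sets M\<close>] that(2)
      by blast
    have "dist1 M (cexp M (z n) (indicator A)) (cexp M w (indicator A)) = 0" if "n \<ge> m" for n
    proof -
      have "A \<in> z n" "A \<in> w"
        using A incseqD[OF inc that] w_ge by auto
      then show ?thesis
        using fixed[OF z, of n] fixed[OF w] dist1_eq_right[OF integrable_cexp[OF w i] i integrable_cexp[OF z i], of n]
        by simp
    qed
    then show "\<exists>N. \<forall>n\<ge>N. dist1 M (cexp M (z n) (indicator A)) (cexp M w (indicator A)) \<le> e" if "e > 0" for e
      using that by (intro exI[of _ m]) auto
  qed
  have "null_sets M \<subseteq> z 0"
    using z[of 0] by (simp add: sigma_fields_def)
  then have w_eq: "w = sigma_sets (space M) (\<Union>n. z n)"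
    by (simp add: w_def sf_Sup_def sf_generated_def) (metis Un_absorb1 SUP_upper2 UNIV_I)
  have sa: "sigma_algebra (space M) (z n)" for n
    using z[of n] by (simp add: sigma_fields_def)
  have Int: "Int_stable (\<Union>n. z n)"
    unfolding Int_stable_def
  proof (intro ballI)
    fix A C assume "A \<in> (\<Union>n. z n)" "C \<in> (\<Union>n. z n)"
    then obtain n m where "A \<in> z n" "C \<in> z m" by auto
    then have AC: "A \<in> z (max n m)" "C \<in> z (max n m)"
      using incseqD[OF inc, of n "max n m"] incseqD[OF inc, of m "max n m"] by auto
    interpret Z: sigma_algebra "space M" "z (max n m)"
      by (rule sa)
    show "A \<inter> C \<in> (\<Union>n. z n)"
      using AC by blast
  qed
  have top: "space M \<in> (\<Union>n. z n)"
    using sa[of 0] by (auto simp: sigma_algebra_iff2 intro!: exI[of _ 0])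
  have conv: "cexp_converges M z w (cexp M w f)"
    using zmem by (intro cexp_converges_if_generator[OF z w w w_eq Int top _ integrable_cexp[OF w f] measurable_cexp]) blast
  have "dist1 M (cexp M (z n) (cexp M w f)) (cexp M w (cexp M w f)) = dist1 M (cexp M (z n) f) (cexp M w f)" for n
  proof -
    have "dist1 M (cexp M (z n) (cexp M w f)) (cexp M w (cexp M w f)) = dist1 M (cexp M (z n) f) (cexp M w (cexp M w f))"
      by (intro dist1_eq_left cexp_tower integrable_cexp z w w_ge f)
    also have "\<dots> = dist1 M (cexp M (z n) f) (cexp M w f)"
      by (intro dist1_eq_right cexp_tower integrable_cexp z w f order_refl)
    finally show ?thesis .
  qed
  with conv show ?thesis
    unfolding cexp_converges_def w_def by simp
qed

section \<open>Independence and commuting conditional expectations\<close>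

lemma cexp_indicator_Int_indep:
  assumes s: "s \<in> sigma_fields M" and A: "A \<in> s" and C: "C \<in> sets M"
    and indep: "\<And>E. E \<in> s \<Longrightarrow> prob (E \<inter> C) = prob E * prob C"
  shows "dist1 M (cexp M s (indicator (A \<inter> C))) (\<lambda>x. prob C * indicator A x) = 0"
proof -
  interpret S: sigma_finite_subalgebra M "sigma (space M) s"
    using s by (rule sigma_finite_sigma_field)
  interpret sa: sigma_algebra "space M" s
    using s by (simp add: sigma_fields_def)
  have sM: "E \<in> sets M" if "E \<in> s" for E
    using that s by (auto simp: sigma_fields_def)
  have "AE x in M. real_cond_exp M (sigma (space M) s) (indicator (A \<inter> C)) x = prob C * indicator A x"
  proof (rule S.real_cond_exp_charact)
    fix E assume "E \<in> sets (sigma (space M) s)"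
    then have E: "E \<in> s"
      by (simp add: sets_sigma_field s)
    have "(\<integral>x\<in>E. indicator (A \<inter> C) x \<partial>M) = (\<integral>x. indicator ((E \<inter> A) \<inter> C) x \<partial>M)"
      unfolding set_lebesgue_integral_def
      by (intro Bochner_Integration.integral_cong refl) (auto simp: indicator_def)
    also have "\<dots> = prob (E \<inter> A) * prob C"
      using indep[OF sa.Int[OF E A]] sM[OF E] sM[OF A] C sets.sets_into_space[OF C]
      by (simp add: Int_absorb2 Int_assoc)
    also have "\<dots> = (\<integral>x. prob C * indicator (E \<inter> A) x \<partial>M)"
      using sM[OF E] sM[OF A] sets.sets_into_space[OF sM[OF A]] by (simp add: Int_absorb2 Int_assoc)
    also have "\<dots> = (\<integral>x\<in>E. prob C * indicator A x \<partial>M)"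
      unfolding set_lebesgue_integral_def
      by (intro Bochner_Integration.integral_cong refl) (auto simp: indicator_def)
    finally show "(\<integral>x\<in>E. indicator (A \<inter> C) x \<partial>M) = (\<integral>x\<in>E. prob C * indicator A x \<partial>M)" .
  next
    show "(\<lambda>x. prob C * indicator A x) \<in> borel_measurable (sigma (space M) s)"
      using A by (intro borel_measurable_times borel_measurable_const borel_measurable_indicator)
        (simp add: sets_sigma_field s)
  qed (use sM[OF A] C in \<open>auto intro!: integrable_indicator_event integrable_mult_right\<close>)
  then show ?thesis
    using sM[OF A] C by (subst dist1_eq_0_iff) (auto simp: cexp_def[symmetric] intro!: integrable_indicator_event integrable_cexp s)
qed

text \<open>On an event \<open>A \<inter> C\<close> with \<open>A \<in> x \<inter> y\<close> and \<open>C \<in> v\<close>, both operators give \<open>P(C)\<close> times the indicator of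
  \<open>A\<close>, and such events generate \<open>x\<close>.  Equality is treated as convergence of a constant sequence,
  so that the Dynkin argument above applies.\<close>
lemma cexp_eq_cexp_Int_if_indep:
  assumes x: "x \<in> sigma_fields M" and y: "y \<in> sigma_fields M" and v: "v \<in> sigma_fields M"
    and x_eq: "x = sf_join M (x \<inter> y) v"
    and indep: "\<And>E C. E \<in> y \<Longrightarrow> C \<in> v \<Longrightarrow> prob (E \<inter> C) = prob E * prob C"
    and f: "integrable M f" "f \<in> borel_measurable (sigma (space M) x)"
  shows "dist1 M (cexp M y f) (cexp M (x \<inter> y) f) = 0"
proof -
  define u where "u = x \<inter> y"
  have u: "u \<in> sigma_fields M"
    unfolding u_def using x y by (rule Int_in_sigma_fields)
  define G where "G = (\<lambda>(A, C). A \<inter> C) ` (u \<times> v)"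
  interpret sau: sigma_algebra "space M" u
    using u by (simp add: sigma_fields_def)
  interpret sav: sigma_algebra "space M" v
    using v by (simp add: sigma_fields_def)
  interpret sax: sigma_algebra "space M" x
    using x by (simp add: sigma_fields_def)
  have ux: "u \<subseteq> x" and vx: "v \<subseteq> x"
    unfolding u_def using x_eq by (auto simp: sf_join_def sf_generated_def intro: sigma_sets.Basic)
  have GI: "A \<inter> C \<in> G" if "A \<in> u" "C \<in> v" for A C
    using that by (auto simp: G_def)
  have x_gen: "x = sigma_sets (space M) G"
  proof
    have "A \<in> G" if "A \<in> u" for A
      using GI[OF that sav.top] sau.sets_into_space[OF that] by (simp add: Int_absorb2)
    moreover have "C \<in> G" if "C \<in> v" for C
      using GI[OF sau.top that] sav.sets_into_space[OF that] by (simp add: Int_absorb1)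
    moreover have "null_sets M \<subseteq> u"
      using u by (simp add: sigma_fields_def)
    ultimately have "null_sets M \<union> (u \<union> v) \<subseteq> G"
      by blast
    then have "sigma_sets (space M) (null_sets M \<union> (u \<union> v)) \<subseteq> sigma_sets (space M) G"
      by (rule sigma_sets_mono')
    then show "x \<subseteq> sigma_sets (space M) G"
      using x_eq by (simp add: u_def sf_join_def sf_generated_def)
    show "sigma_sets (space M) G \<subseteq> x"
      using ux vx by (intro sax.sigma_sets_subset) (auto simp: G_def)
  qed
  have stable: "Int_stable G"
    unfolding Int_stable_def
  proof (intro ballI)
    fix P Q assume "P \<in> G" "Q \<in> G"
    then obtain A C A' C' where "P = A \<inter> C" "Q = A' \<inter> C'" "A \<in> u" "A' \<in> u" "C \<in> v" "C' \<in> v"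
      by (auto simp: G_def)
    moreover from this have "P \<inter> Q = (A \<inter> A') \<inter> (C \<inter> C')"
      by blast
    ultimately show "P \<inter> Q \<in> G"
      using GI[OF sau.Int sav.Int, of A A' C C'] by simp
  qed
  have top: "space M \<in> G"
    using GI[OF sau.top sav.top] by simp
  have "cexp_converges M (\<lambda>_. y) u (indicator P)" if P: "P \<in> G" for P
  proof -
    obtain A C where AC: "P = A \<inter> C" "A \<in> u" "C \<in> v"
      using P by (auto simp: G_def)
    have A: "A \<in> sets M" and C: "C \<in> sets M"
      using AC u v by (auto simp: sigma_fields_def)
    have uy: "u \<subseteq> y"
      by (auto simp: u_def)
    have "dist1 M (cexp M y (indicator P)) (\<lambda>x. prob C * indicator A x) = 0"
      unfolding AC(1) using AC uy by (intro cexp_indicator_Int_indep y C indep) auto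
    moreover have "dist1 M (cexp M u (indicator P)) (\<lambda>x. prob C * indicator A x) = 0"
      unfolding AC(1) using AC uy by (intro cexp_indicator_Int_indep u C indep) auto
    ultimately have "dist1 M (cexp M y (indicator P)) (cexp M u (indicator P)) = 0"
      using A C AC(1) dist1_eq_right[of M "cexp M u (indicator P)" "\<lambda>x. prob C * indicator A x" "cexp M y (indicator P)"]
      by (simp add: integrable_indicator_event integrable_cexp u y)
    then show ?thesis
      by (simp add: cexp_converges_def)
  qed
  then have "cexp_converges M (\<lambda>_. y) u f"
    by (rule cexp_converges_if_generator[OF y u x x_gen stable top _ f])
  then show ?thesis
    by (simp add: cexp_converges_def u_def LIMSEQ_const_iff)
qed

text \<open>The second generator is \<open>v = x \<inter> y'\<close>: distributivity splits \<open>x = x \<inter> (y \<or> y')\<close>.\<close>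
lemma noise_type_cexp_comp:
  assumes B: "noise_type_Boolean_algebra M B" and xy: "x \<in> B" "y \<in> B" and f: "integrable M f"
  shows "dist1 M (cexp M y (cexp M x f)) (cexp M (x \<inter> y) f) = 0"
proof -
  have B_sub: "B \<subseteq> sigma_fields M"
    using B by (simp add: noise_type_Boolean_algebra_def)
  obtain y' where y': "y' \<in> B" "sf_complement M y y'"
    using B xy by (auto simp: noise_type_Boolean_algebra_def)
  have indep: "indep_set y y'"
    using B xy y' by (auto simp: noise_type_Boolean_algebra_def)
  have x: "x \<in> sigma_fields M" and y: "y \<in> sigma_fields M" and xy': "x \<inter> y' \<in> sigma_fields M"
    using B_sub xy y'(1) by (auto intro!: Int_in_sigma_fields)
  have u: "x \<inter> y \<in> sigma_fields M"
    using x y by (rule Int_in_sigma_fields)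
  have "x \<inter> sf_join M y y' = sf_join M (x \<inter> y) (x \<inter> y')"
    using B xy y' unfolding noise_type_Boolean_algebra_def by blast
  moreover have "x \<inter> sf_join M y y' = x"
    using y'(2) x by (auto simp: sf_complement_def sigma_fields_def)
  ultimately have "x = sf_join M (x \<inter> y) (x \<inter> y')"
    by simp
  moreover have "prob (E \<inter> C) = prob E * prob C" if "E \<in> y" "C \<in> x \<inter> y'" for E C
    using indep_setD[OF indep that(1)] that(2) by simp
  ultimately have "dist1 M (cexp M y (cexp M x f)) (cexp M (x \<inter> y) (cexp M x f)) = 0"
    by (rule cexp_eq_cexp_Int_if_indep[OF x y xy' _ _ integrable_cexp[OF x f] measurable_cexp])
  moreover have "dist1 M (cexp M (x \<inter> y) (cexp M x f)) (cexp M (x \<inter> y) f) = 0"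
    by (rule cexp_tower[OF u x _ f]) simp
  ultimately show ?thesis
    using dist1_eq_left[of M "cexp M y (cexp M x f)" "cexp M (x \<inter> y) (cexp M x f)" "cexp M (x \<inter> y) f"]
    by (simp add: integrable_cexp x y u f)
qed

end

section \<open>The closure in the strong operator topology\<close>

definition strong_closure :: "'a measure \<Rightarrow> 'a set set set \<Rightarrow> 'a set set set" where
  "strong_closure M B = {x \<in> sigma_fields M. \<forall>F. finite F \<longrightarrow> (\<forall>f\<in>F. integrable M f) \<longrightarrow>
     (\<forall>e>0. \<exists>y\<in>B. \<forall>f\<in>F. dist1 M (cexp M y f) (cexp M x f) < e)}"

text \<open>What remains of a noise-type Boolean algebra once complements and independence have been used
  to obtain the composition rule.\<close>
locale commuting_sigma_fields = prob_space M for M :: "'a measure" +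
  fixes B :: "'a set set set"
  assumes B_sub: "B \<subseteq> sigma_fields M"
    and B_Int: "x \<in> B \<Longrightarrow> y \<in> B \<Longrightarrow> x \<inter> y \<in> B"
    and B_comp: "x \<in> B \<Longrightarrow> y \<in> B \<Longrightarrow> integrable M f \<Longrightarrow>
      dist1 M (cexp M y (cexp M x f)) (cexp M (x \<inter> y) f) = 0"
begin

abbreviation "K \<equiv> strong_closure M B"

lemma B_sigma_field: "x \<in> B \<Longrightarrow> x \<in> sigma_fields M"
  using B_sub by blast

lemma strong_closure_sigma_field: "x \<in> K \<Longrightarrow> x \<in> sigma_fields M"
  by (simp add: strong_closure_def)

lemma strong_closure_approx:
  assumes "x \<in> K" "finite F" "\<And>f. f \<in> F \<Longrightarrow> integrable M f" "e > 0"
  shows "\<exists>y\<in>B. \<forall>f\<in>F. dist1 M (cexp M y f) (cexp M x f) < e"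
  using assms by (simp add: strong_closure_def)

lemma B_subset_strong_closure: "B \<subseteq> K"
proof
  fix x assume x: "x \<in> B"
  then have "\<forall>f\<in>F. dist1 M (cexp M x f) (cexp M x f) < e" if "e > 0" for e F
    using that by (simp add: dist1_self)
  then show "x \<in> K"
    unfolding strong_closure_def using x B_sigma_field[OF x] by blast
qed

text \<open>Replacing \<open>Q\<^sub>x\<close> and \<open>Q\<^sub>y\<close> by \<open>Q\<^sub>u\<close> and \<open>Q\<^sub>v\<close> with \<open>u, v \<in> B\<close> costs at most the error of \<open>v\<close> at \<open>f\<close> plus
  that of \<open>u\<close> at \<open>Q\<^sub>y f\<close>, as \<open>Q\<^sub>u\<close> is a contraction.  Approximating the images as well as
  \<open>F\<close> makes one element \<open>u \<inter> v\<close> serve both orders of composition, from which commutativity follows.\<close>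
lemma strong_closure_comp_approx:
  assumes x: "x \<in> K" and y: "y \<in> K" and F: "finite F" "\<And>f. f \<in> F \<Longrightarrow> integrable M f" and e: "e > 0"
  shows "\<exists>w\<in>B. \<forall>f\<in>F. dist1 M (cexp M w f) (cexp M x (cexp M y f)) < e
    \<and> dist1 M (cexp M w f) (cexp M y (cexp M x f)) < e"
proof -
  note sx = strong_closure_sigma_field[OF x] and sy = strong_closure_sigma_field[OF y]
  have e2: "e / 2 > 0" using e by simp
  have "\<exists>u\<in>B. \<forall>f\<in>F \<union> cexp M y ` F. dist1 M (cexp M u f) (cexp M x f) < e / 2"
    using F by (intro strong_closure_approx x e2) (auto intro: integrable_cexp[OF sy])
  then obtain u where u: "u \<in> B" "\<And>f. f \<in> F \<union> cexp M y ` F \<Longrightarrow> dist1 M (cexp M u f) (cexp M x f) < e / 2"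
    by blast
  have "\<exists>v\<in>B. \<forall>f\<in>F \<union> cexp M x ` F. dist1 M (cexp M v f) (cexp M y f) < e / 2"
    using F by (intro strong_closure_approx y e2) (auto intro: integrable_cexp[OF sx])
  then obtain v where v: "v \<in> B" "\<And>f. f \<in> F \<union> cexp M x ` F \<Longrightarrow> dist1 M (cexp M v f) (cexp M y f) < e / 2"
    by blast
  have est: "dist1 M (cexp M (p \<inter> q) f) (cexp M a (cexp M b f)) < e"
    if p: "p \<in> B" and q: "q \<in> B" and a: "a \<in> sigma_fields M" and b: "b \<in> sigma_fields M"
      and f: "integrable M f"
      and qb: "dist1 M (cexp M q f) (cexp M b f) < e / 2"
      and pa: "dist1 M (cexp M p (cexp M b f)) (cexp M a (cexp M b f)) < e / 2" for p q a b f
  proof -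
    note sp = B_sigma_field[OF p] and sq = B_sigma_field[OF q]
    have spq: "p \<inter> q \<in> sigma_fields M"
      using sp sq by (rule Int_in_sigma_fields)
    note int = integrable_cexp[OF sp] integrable_cexp[OF sq] integrable_cexp[OF a] integrable_cexp[OF b]
      integrable_cexp[OF spq]
    have "dist1 M (cexp M (p \<inter> q) f) (cexp M a (cexp M b f)) = dist1 M (cexp M p (cexp M q f)) (cexp M a (cexp M b f))"
      using B_comp[OF q p f] by (intro dist1_eq_left[symmetric] int f) (simp add: Int_commute)
    also have "\<dots> \<le> dist1 M (cexp M p (cexp M q f)) (cexp M p (cexp M b f))
        + dist1 M (cexp M p (cexp M b f)) (cexp M a (cexp M b f))"
      by (intro dist1_triangle int f)
    also have "dist1 M (cexp M p (cexp M q f)) (cexp M p (cexp M b f)) \<le> dist1 M (cexp M q f) (cexp M b f)"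
      by (intro dist1_cexp_le sp int f)
    finally show ?thesis
      using qb pa by simp
  qed
  show ?thesis
  proof (intro bexI[of _ "u \<inter> v"] ballI conjI)
    show "u \<inter> v \<in> B"
      using u v B_Int by blast
    fix f assume f: "f \<in> F"
    show "dist1 M (cexp M (u \<inter> v) f) (cexp M x (cexp M y f)) < e"
      using f u(2) v(2) by (intro est u(1) v(1) sx sy F) auto
    have "dist1 M (cexp M (v \<inter> u) f) (cexp M y (cexp M x f)) < e"
      using f u(2) v(2) by (intro est u(1) v(1) sx sy F) auto
    then show "dist1 M (cexp M (u \<inter> v) f) (cexp M y (cexp M x f)) < e"
      by (simp add: Int_commute)
  qed
qed

lemma strong_closure_commute:
  assumes x: "x \<in> K" and y: "y \<in> K" and f: "integrable M f"
  shows "dist1 M (cexp M x (cexp M y f)) (cexp M y (cexp M x f)) = 0"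
proof (rule dist1_eq_0I)
  note int = integrable_cexp[OF strong_closure_sigma_field[OF x]] integrable_cexp[OF strong_closure_sigma_field[OF y]]
  fix e :: real assume "e > 0"
  then have "e / 2 > 0" by simp
  with strong_closure_comp_approx[OF x y, of "{f}" "e / 2"] f obtain w where w: "w \<in> B"
    "dist1 M (cexp M w f) (cexp M x (cexp M y f)) < e / 2"
    "dist1 M (cexp M w f) (cexp M y (cexp M x f)) < e / 2"
    by auto
  have "dist1 M (cexp M x (cexp M y f)) (cexp M y (cexp M x f))
    \<le> dist1 M (cexp M x (cexp M y f)) (cexp M w f) + dist1 M (cexp M w f) (cexp M y (cexp M x f))"
    by (intro dist1_triangle int integrable_cexp[OF B_sigma_field[OF w(1)]] f)
  then show "dist1 M (cexp M x (cexp M y f)) (cexp M y (cexp M x f)) \<le> e"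
    using w(2,3) dist1_commute[of M "cexp M w f" "cexp M x (cexp M y f)"] by linarith
qed

text \<open>By commutativity \<open>Q\<^sub>x Q\<^sub>y f\<close> is fixed by both operators, hence measurable for the intersection,
  and \<open>Q\<^bsub>x \<inter> y\<^esub>\<close> sends it to \<open>Q\<^bsub>x \<inter> y\<^esub> f\<close> by the tower property.\<close>
lemma strong_closure_comp:
  assumes x: "x \<in> K" and y: "y \<in> K" and f: "integrable M f"
  shows "dist1 M (cexp M x (cexp M y f)) (cexp M (x \<inter> y) f) = 0"
proof -
  note sx = strong_closure_sigma_field[OF x] and sy = strong_closure_sigma_field[OF y]
  have su: "x \<inter> y \<in> sigma_fields M"
    using sx sy by (rule Int_in_sigma_fields)
  note int = integrable_cexp[OF sx] integrable_cexp[OF sy] integrable_cexp[OF su]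
  define g where "g = cexp M x (cexp M y f)"
  have gi: "integrable M g"
    unfolding g_def by (intro int f)
  have gx: "g \<in> borel_measurable (sigma (space M) x)"
    unfolding g_def by (rule measurable_cexp)
  have "dist1 M (cexp M y g) g = dist1 M (cexp M y (cexp M y (cexp M x f))) g"
    unfolding g_def by (intro dist1_eq_left dist1_cexp_cong[OF sy] strong_closure_commute x y int f)
  also have "\<dots> = dist1 M (cexp M y (cexp M x f)) g"
    by (intro dist1_eq_left cexp_absorb sy order_refl int gi f)
  also have "\<dots> = 0"
    unfolding g_def by (intro strong_closure_commute x y f)
  finally have gy: "g \<in> borel_measurable (sigma (space M) y)"
    using cexp_fixed_iff[OF sy gi] by simp
  have "g \<in> borel_measurable (sigma (space M) (x \<inter> y))"
    using gx gy by (simp add: borel_measurable_sigma_field_iff sx sy su)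
  then have "dist1 M (cexp M (x \<inter> y) g) g = 0"
    using cexp_fixed_iff[OF su gi] by simp
  then have "dist1 M g (cexp M (x \<inter> y) f) = dist1 M (cexp M (x \<inter> y) g) (cexp M (x \<inter> y) f)"
    by (intro dist1_eq_left[symmetric] int gi f)
  also have "\<dots> = dist1 M (cexp M (x \<inter> y) (cexp M y f)) (cexp M (x \<inter> y) f)"
    unfolding g_def by (intro dist1_eq_left cexp_tower su sx int f) auto
  also have "\<dots> = 0"
    by (intro cexp_tower su sy f) auto
  finally show ?thesis
    by (simp add: g_def)
qed

lemma strong_closure_Int:
  assumes x: "x \<in> K" and y: "y \<in> K"
  shows "x \<inter> y \<in> K"
proof -
  note sx = strong_closure_sigma_field[OF x] and sy = strong_closure_sigma_field[OF y]
  have su: "x \<inter> y \<in> sigma_fields M"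
    using sx sy by (rule Int_in_sigma_fields)
  have "\<exists>w\<in>B. \<forall>f\<in>F. dist1 M (cexp M w f) (cexp M (x \<inter> y) f) < e"
    if F: "finite F" "\<forall>f\<in>F. integrable M f" and e: "e > 0" for F and e :: real
  proof -
    have "\<exists>w\<in>B. \<forall>f\<in>F. dist1 M (cexp M w f) (cexp M x (cexp M y f)) < e
        \<and> dist1 M (cexp M w f) (cexp M y (cexp M x f)) < e"
      using F(2) by (intro strong_closure_comp_approx x y F(1) e) blast
    then obtain w where w: "w \<in> B" "\<And>f. f \<in> F \<Longrightarrow> dist1 M (cexp M w f) (cexp M x (cexp M y f)) < e"
      by blast
    have "dist1 M (cexp M w f) (cexp M (x \<inter> y) f) < e" if "f \<in> F" for f
    proof -
      have f: "integrable M f"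
        using F(2) that by blast
      have "dist1 M (cexp M w f) (cexp M (x \<inter> y) f) = dist1 M (cexp M w f) (cexp M x (cexp M y f))"
        by (intro dist1_eq_right[symmetric] strong_closure_comp x y f integrable_cexp sx sy su B_sigma_field[OF w(1)])
      then show ?thesis
        using w(2)[OF that] by simp
    qed
    then show ?thesis
      using w(1) by blast
  qed
  then show ?thesis
    using su by (simp add: strong_closure_def)
qed

lemma strong_closure_limit:
  assumes z: "\<And>n. z n \<in> K" and w: "w \<in> sigma_fields M"
    and conv: "\<And>f. integrable M f \<Longrightarrow> cexp_converges M z w f"
  shows "w \<in> K"
proof -
  have "\<exists>y\<in>B. \<forall>f\<in>F. dist1 M (cexp M y f) (cexp M w f) < e"
    if F: "finite F" "\<forall>f\<in>F. integrable M f" and e: "e > 0" for F and e :: real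
  proof -
    have e2: "e / 2 > 0" using e by simp
    have "\<forall>f\<in>F. \<forall>\<^sub>F n in sequentially. dist1 M (cexp M (z n) f) (cexp M w f) < e / 2"
      using order_tendstoD(2)[OF conv[unfolded cexp_converges_def] e2] F(2) by blast
    then have "\<forall>\<^sub>F n in sequentially. \<forall>f\<in>F. dist1 M (cexp M (z n) f) (cexp M w f) < e / 2"
      using F(1) by (simp add: eventually_ball_finite)
    from eventually_happens[OF this]
    obtain n where n: "\<And>f. f \<in> F \<Longrightarrow> dist1 M (cexp M (z n) f) (cexp M w f) < e / 2"
      by auto
    have "\<exists>y\<in>B. \<forall>f\<in>F. dist1 M (cexp M y f) (cexp M (z n) f) < e / 2"
      using F(2) by (intro strong_closure_approx z F(1) e2) blast
    then obtain y where y: "y \<in> B" "\<And>f. f \<in> F \<Longrightarrow> dist1 M (cexp M y f) (cexp M (z n) f) < e / 2"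
      by blast
    have "dist1 M (cexp M y f) (cexp M w f) < e" if f: "f \<in> F" for f
    proof -
      have "integrable M f"
        using f F(2) by blast
      then have "dist1 M (cexp M y f) (cexp M w f)
          \<le> dist1 M (cexp M y f) (cexp M (z n) f) + dist1 M (cexp M (z n) f) (cexp M w f)"
        by (intro dist1_triangle integrable_cexp B_sigma_field y(1) strong_closure_sigma_field z w)
      then show ?thesis
        using n[OF f] y(2)[OF f] by linarith
    qed
    then show ?thesis
      using y(1) by blast
  qed
  then show ?thesis
    using w by (simp add: strong_closure_def)
qed

lemma sf_Inf_eq_Inf_partial_Int:
  "sf_Inf M (range x) = sf_Inf M (range (\<lambda>n. \<Inter>i\<le>n. x i))" for x :: "nat \<Rightarrow> 'a set set"
  by (auto simp: sf_Inf_def)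

lemma strong_closure_finite_Int: "(\<And>i. x i \<in> K) \<Longrightarrow> (\<Inter>i\<le>n. x i) \<in> K" for x :: "nat \<Rightarrow> 'a set set" and n :: nat
  by (induction n) (auto simp: atMost_Suc strong_closure_Int)

lemma strong_closure_Inf:
  fixes x :: "nat \<Rightarrow> 'a set set"
  assumes x: "\<And>n. x n \<in> K"
  shows "sf_Inf M (range x) \<in> K"
proof (rule strong_closure_limit)
  let ?z = "\<lambda>n. \<Inter>i\<le>n. x i"
  show z: "?z n \<in> K" for n
    using x by (rule strong_closure_finite_Int)
  show "sf_Inf M (range x) \<in> sigma_fields M"
    using strong_closure_sigma_field[OF x] by (intro sf_Inf_greatest_lower_bound) auto
  have "decseq ?z"
    by (intro antimonoI INF_superset_mono) auto
  then show "cexp_converges M ?z (sf_Inf M (range x)) f" if "integrable M f" for f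
    unfolding sf_Inf_eq_Inf_partial_Int[of x] using strong_closure_sigma_field[OF z] that by (intro cexp_converges_decreasing)
qed

lemma strong_closure_Sup:
  fixes x :: "nat \<Rightarrow> 'a set set"
  assumes x: "\<And>n. x n \<in> K" and "incseq x"
  shows "sf_Sup M (range x) \<in> K"
proof (rule strong_closure_limit[OF x])
  show "sf_Sup M (range x) \<in> sigma_fields M"
    using strong_closure_sigma_field[OF x] by (intro sf_Sup_least_upper_bound) auto
  show "cexp_converges M x (sf_Sup M (range x)) f" if "integrable M f" for f
    using strong_closure_sigma_field[OF x] assms(2) that by (intro cexp_converges_increasing)
qed

section \<open>Lower limits\<close>

lemma incseq_tail_Inf: "incseq (\<lambda>n. sf_Inf M (range (\<lambda>k. x (n + k))))" for x :: "nat \<Rightarrow> 'a set set"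
proof (rule incseq_SucI)
  fix n
  have "range (\<lambda>k. x (Suc n + k)) \<subseteq> range (\<lambda>k. x (n + k))"
    by (metis (no_types, lifting) add_Suc_shift image_subsetI rangeI)
  then show "sf_Inf M (range (\<lambda>k. x (n + k))) \<subseteq> sf_Inf M (range (\<lambda>k. x (Suc n + k)))"
    by (auto simp: sf_Inf_def)
qed

lemma Cl_subset_strong_closure: "Cl M B \<subseteq> K"
proof
  fix w assume "w \<in> Cl M B"
  then obtain x where x: "w = sf_liminf M x" "\<And>n. x n \<in> B"
    by (auto simp: Cl_def)
  then have "x n \<in> K" for n
    using B_subset_strong_closure by blast
  then show "w \<in> K"
    unfolding x(1) sf_liminf_def by (intro strong_closure_Sup strong_closure_Inf incseq_tail_Inf)
qed

text \<open>Let \<open>y\<^sub>n \<in> B\<close> approximate \<open>x\<close> within \<open>2^(-n)\<close> on \<open>d\<^sub>0, \<dots>, d\<^sub>n\<close>, let \<open>w\<^sub>n\<close> be the infimum of the tail from \<open>n\<close>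
  and \<open>l\<close> the supremum of the \<open>w\<^sub>n\<close>.  An event of \<open>w\<^sub>n\<close> is fixed by \<open>Q\<^bsub>y\<^sub>m\<^esub>\<close> for all \<open>m \<ge> n\<close>, hence by the
  limit \<open>Q\<^sub>x\<close>; so \<open>l \<subseteq> x\<close>.  For the converse, \<open>g = Q\<^sub>x d\<^sub>i\<close> is moved by \<open>Q\<^bsub>y\<^sub>m\<^esub>\<close> by at most \<open>2^(-m)\<close>
  for \<open>m \<ge> i\<close>, since \<open>Q\<^bsub>y\<^sub>m\<^esub>\<close> commutes with \<open>Q\<^sub>x\<close>.  Its distance to \<open>Q\<^bsub>w\<^sub>n\<^esub> g\<close>, the limit of the products of these
  operators, is then at most \<open>2^(-n) + 2^(-n-1) + \<dots>\<close>.  Events of \<open>x\<close> are approximated by such \<open>g\<close>, and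
  therefore by \<open>l\<close>-measurable functions.\<close>
lemma strong_closure_subset_Cl:
  assumes sep: "\<And>i. integrable M (d i)" "\<And>A e. A \<in> sets M \<Longrightarrow> e > 0 \<Longrightarrow> \<exists>i::nat. dist1 M (indicator A) (d i) < e"
  shows "K \<subseteq> Cl M B"
proof
  fix x assume x: "x \<in> K"
  note sx = strong_closure_sigma_field[OF x]
  have "\<exists>y\<in>B. \<forall>f\<in>d ` {..n}. dist1 M (cexp M y f) (cexp M x f) < (1/2)^n" for n :: nat
    using sep(1) by (intro strong_closure_approx x) auto
  then have "\<exists>y. \<forall>n. y n \<in> B \<and> (\<forall>f\<in>d ` {..n}. dist1 M (cexp M (y n) f) (cexp M x f) < (1/2)^n)"
    by (intro choice) blast
  then obtain y where yB: "\<And>n. y n \<in> B"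
    and y: "\<And>n i. i \<le> n \<Longrightarrow> dist1 M (cexp M (y n) (d i)) (cexp M x (d i)) < (1/2)^n"
    by auto
  note sy = B_sigma_field[OF yB]
  have yK: "y n \<in> K" for n
    using yB B_subset_strong_closure by blast
  define w where "w n = sf_Inf M (range (\<lambda>k. y (n + k)))" for n
  define l where "l = sf_Sup M (range w)"
  have wK: "w n \<in> K" for n
    unfolding w_def by (intro strong_closure_Inf yK)
  note sw = strong_closure_sigma_field[OF wK]
  have sl: "l \<in> sigma_fields M" and wl: "w n \<subseteq> l" for n
    unfolding l_def using sw sf_Sup_least_upper_bound[of "range w" M] by blast+
  have half: "\<exists>m. N \<le> m \<and> (1/2)^m < e" if e: "e > 0" for e :: real and N :: nat
  proof -
    obtain m where m: "(1/2)^m < e"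
      using real_arch_pow_inv[OF e, of "1/2"] by auto
    have "(1/2::real)^(max N m) \<le> (1/2)^m"
      by (intro power_decreasing) auto
    then have "(1/2)^(max N m) < e"
      using m by (rule le_less_trans)
    then show ?thesis
      using max.cobounded1 by blast
  qed
  have "l \<subseteq> x"
    unfolding l_def
  proof (rule sf_Sup_least_upper_bound(3)[OF _ sx])
    show "range w \<subseteq> sigma_fields M"
      using sw by blast
    fix u assume "u \<in> range w"
    then obtain n where u: "u = w n" by blast
    show "u \<subseteq> x"
    proof
      fix A assume "A \<in> u"
      then have AM: "A \<in> sets M" and Ay: "A \<in> y (n + k)" for k
        by (auto simp: u w_def sf_Inf_def)
      let ?f = "indicator A :: 'a \<Rightarrow> real"
      note f = integrable_indicator_event[OF AM]
      have "dist1 M (cexp M x ?f) ?f = 0"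
      proof (rule dist1_eq_0I)
        fix e :: real assume "e > 0"
        then have e3: "e / 3 > 0" by simp
        obtain i where i: "dist1 M ?f (d i) < e / 3"
          using sep(2)[OF AM e3] by blast
        obtain m where m: "max n i \<le> m" "(1/2)^m < e / 3"
          using half[OF e3] by blast
        have "A \<in> y m"
          using Ay[of "m - n"] m(1) by simp
        then have "dist1 M (cexp M (y m) ?f) ?f = 0"
          using cexp_fixed_iff[OF sy f] indicator_measurable_sigma_field_iff[OF sy AM] by blast
        then have "dist1 M (cexp M x ?f) ?f = dist1 M (cexp M x ?f) (cexp M (y m) ?f)"
          by (intro dist1_eq_right[symmetric] integrable_cexp sx sy f)
        also have "\<dots> \<le> 2 * dist1 M ?f (d i) + dist1 M (cexp M x (d i)) (cexp M (y m) (d i))"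
          by (intro dist1_cexp_approx sx sy f sep(1))
        also have "dist1 M (cexp M x (d i)) (cexp M (y m) (d i)) < e / 3"
          using y[of i m] m by (simp add: dist1_commute)
        finally show "dist1 M (cexp M x ?f) ?f \<le> e"
          using i by simp
      qed
      then show "A \<in> x"
        using cexp_fixed_iff[OF sx f] indicator_measurable_sigma_field_iff[OF sx AM] by blast
    qed
  qed
  have near: "dist1 M (cexp M (w n) (cexp M x (d i))) (cexp M x (d i)) \<le> 2 * (1/2)^n" if ni: "i \<le> n" for n i
  proof -
    define g where "g = cexp M x (d i)"
    have gi: "integrable M g"
      unfolding g_def by (intro integrable_cexp sx sep(1))
    define v where "v k = (\<Inter>j\<le>k. y (n + j))" for k
    have vB: "v k \<in> B" for k
      unfolding v_def by (induction k) (auto simp: atMost_Suc yB B_Int)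
    note sv = B_sigma_field[OF vB]
    have step: "dist1 M (cexp M (y m) g) g \<le> (1/2)^m" if m: "i \<le> m" for m
    proof -
      have "dist1 M (cexp M (y m) g) g = dist1 M (cexp M x (cexp M (y m) (d i))) g"
        unfolding g_def by (intro dist1_eq_left strong_closure_commute yK x sep(1) integrable_cexp sx sy)
      also have "\<dots> = dist1 M (cexp M x (cexp M (y m) (d i))) (cexp M x (cexp M x (d i)))"
        unfolding g_def by (intro dist1_eq_right[symmetric] cexp_absorb sx order_refl sep(1) integrable_cexp sy)
      also have "\<dots> \<le> dist1 M (cexp M (y m) (d i)) (cexp M x (d i))"
        by (intro dist1_cexp_le sx integrable_cexp sy sep(1))
      finally show ?thesis
        using y[OF m] by simp
    qed
    \<comment> \<open>the bound is the partial geometric sum from \<open>n\<close> to \<open>n + k\<close>\<close>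
    have bound: "dist1 M (cexp M (v k) g) g \<le> 2 * (1/2)^n - (1/2)^(n + k)" for k
    proof (induction k)
      case 0
      show ?case
        using step[OF ni] by (simp add: v_def)
    next
      case (Suc k)
      have v_Suc: "v (Suc k) = y (n + Suc k) \<inter> v k"
        by (auto simp: v_def atMost_Suc)
      have "dist1 M (cexp M (v (Suc k)) g) g = dist1 M (cexp M (v k) (cexp M (y (n + Suc k)) g)) g"
        unfolding v_Suc
        by (intro dist1_eq_left[symmetric] B_comp yB vB gi integrable_cexp sv sy Int_in_sigma_fields)
      also have "\<dots> \<le> dist1 M (cexp M (v k) (cexp M (y (n + Suc k)) g)) (cexp M (v k) g)
          + dist1 M (cexp M (v k) g) g"
        by (intro dist1_triangle gi integrable_cexp sv sy)
      also have "dist1 M (cexp M (v k) (cexp M (y (n + Suc k)) g)) (cexp M (v k) g)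
          \<le> dist1 M (cexp M (y (n + Suc k)) g) g"
        by (intro dist1_cexp_le gi integrable_cexp sv sy)
      also have "\<dots> \<le> (1/2)^(n + Suc k)"
        using ni by (intro step) simp
      finally show ?case
        using Suc.IH by simp
    qed
    have "decseq v"
      unfolding v_def by (intro antimonoI INF_superset_mono) auto
    then have "cexp_converges M v (w n) g"
      unfolding w_def sf_Inf_eq_Inf_partial_Int[of "\<lambda>k. y (n + k)"] v_def[symmetric]
      by (intro cexp_converges_decreasing sv gi)
    then have lim: "(\<lambda>k. 2 * (1/2)^n + dist1 M (cexp M (v k) g) (cexp M (w n) g)) \<longlonglongrightarrow> 2 * (1/2)^n + 0"
      unfolding cexp_converges_def by (intro tendsto_add tendsto_const)
    have "dist1 M (cexp M (w n) g) g \<le> 2 * (1/2)^n + dist1 M (cexp M (v k) g) (cexp M (w n) g)" for k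
    proof -
      have "dist1 M (cexp M (w n) g) g \<le> dist1 M (cexp M (w n) g) (cexp M (v k) g) + dist1 M (cexp M (v k) g) g"
        by (intro dist1_triangle gi integrable_cexp sv sw)
      moreover have "(0::real) \<le> (1/2)^(n + k)" by simp
      ultimately show ?thesis
        using bound[of k] dist1_commute[of M "cexp M (w n) g" "cexp M (v k) g"] by linarith
    qed
    then have "dist1 M (cexp M (w n) g) g \<le> 2 * (1/2)^n + 0"
      by (intro LIMSEQ_le_const[OF lim]) blast
    then show ?thesis
      by (simp add: g_def)
  qed
  have "x \<subseteq> l"
  proof
    fix A assume A: "A \<in> x"
    then have AM: "A \<in> sets M"
      using sx by (auto simp: sigma_fields_def)
    let ?f = "indicator A :: 'a \<Rightarrow> real"
    note f = integrable_indicator_event[OF AM]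
    have fx: "dist1 M (cexp M x ?f) ?f = 0"
      using A cexp_fixed_iff[OF sx f] indicator_measurable_sigma_field_iff[OF sx AM] by blast
    have "dist1 M (cexp M l ?f) ?f = 0"
    proof (rule dist1_eq_0I)
      fix e :: real assume "e > 0"
      then have e4: "e / 4 > 0" "e / 8 > 0" by simp_all
      obtain i where i: "dist1 M ?f (d i) < e / 4"
        using sep(2)[OF AM e4(1)] by blast
      obtain n where n: "i \<le> n" "(1/2)^n < e / 8"
        using half[OF e4(2)] by blast
      define g where "g = cexp M x (d i)"
      define h where "h = cexp M (w n) g"
      have gi: "integrable M g"
        unfolding g_def by (intro integrable_cexp sx sep(1))
      have hi: "integrable M h"
        unfolding h_def by (intro integrable_cexp sw gi)
      have "dist1 M ?f g = dist1 M (cexp M x ?f) g"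
        by (intro dist1_eq_left[symmetric] fx integrable_cexp sx f gi)
      also have "\<dots> \<le> dist1 M ?f (d i)"
        unfolding g_def by (intro dist1_cexp_le sx f sep(1))
      finally have fg: "dist1 M ?f g < e / 4"
        using i by simp
      have gh: "dist1 M g h < e / 4"
        using near[OF n(1)] n(2) dist1_commute[of M g h] by (simp add: g_def h_def)
      have fh: "dist1 M ?f h < e / 2"
        using dist1_triangle[OF f gi hi] fg gh by simp
      have "dist1 M (cexp M l h) h = 0"
        unfolding h_def by (intro cexp_absorb sw sl wl gi)
      then have "dist1 M (cexp M l ?f) h = dist1 M (cexp M l ?f) (cexp M l h)"
        by (intro dist1_eq_right[symmetric] integrable_cexp sl f hi)
      also have "\<dots> \<le> dist1 M ?f h"
        by (intro dist1_cexp_le sl f hi)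
      finally show "dist1 M (cexp M l ?f) ?f \<le> e"
        using dist1_triangle[OF integrable_cexp[OF sl f] hi f] fh dist1_commute[of M h ?f] by simp
    qed
    then show "A \<in> l"
      using cexp_fixed_iff[OF sl f] indicator_measurable_sigma_field_iff[OF sl AM] by blast
  qed
  with \<open>l \<subseteq> x\<close> have "x = sf_liminf M y"
    by (auto simp: l_def w_def sf_liminf_def)
  then show "x \<in> Cl M B"
    using yB by (auto simp: Cl_def)
qed

end

lemma (in prob_space) separable_L2_imp_dense_sequence:
  assumes "separable_L2 M"
  obtains d :: "nat \<Rightarrow> 'a \<Rightarrow> real" where "\<And>i. integrable M (d i)"
    "\<And>A e. A \<in> sets M \<Longrightarrow> e > 0 \<Longrightarrow> \<exists>i. dist1 M (indicator A) (d i) < e"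
proof -
  obtain D where D: "countable D" "D \<subseteq> L2_functions M"
    and dense: "\<And>f e. f \<in> L2_functions M \<Longrightarrow> e > 0 \<Longrightarrow> \<exists>g\<in>D. L2_dist M f g < e"
    using assms by (auto simp: separable_L2_def)
  have L2_int: "integrable M f" if "f \<in> L2_functions M" for f
    using that by (auto simp: L2_functions_def dest: square_integrable_imp_integrable)
  have ind: "indicator A \<in> L2_functions M" if "A \<in> sets M" for A
  proof -
    have "(\<lambda>\<omega>. (indicator A \<omega> :: real)\<^sup>2) = indicator A"
      by (auto simp: indicator_def)
    then show ?thesis
      using that by (simp add: L2_functions_def integrable_real_indicator emeasure_eq_measure)
  qed
  have "D \<noteq> {}"
    using dense[OF ind[OF sets.top] zero_less_one] by blast
  then have range: "range (from_nat_into D) = D"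
    using D(1) by (simp add: range_from_nat_into)
  show thesis
  proof
    show "integrable M (from_nat_into D i)" for i
      using range D(2) by (intro L2_int) auto
    fix A e assume A: "A \<in> sets M" and e: "(e::real) > 0"
    obtain g where g: "g \<in> D" "L2_dist M (indicator A) g < e"
      using dense[OF ind[OF A] e] by blast
    have g2: "g \<in> L2_functions M"
      using g(1) D(2) by blast
    have "integrable M (\<lambda>x. (indicator A x - g x)\<^sup>2)"
    proof (rule Bochner_Integration.integrable_bound)
      show "integrable M (\<lambda>x. 2 * (indicator A x :: real)\<^sup>2 + 2 * (g x)\<^sup>2)"
        using g2 ind[OF A] by (auto simp: L2_functions_def)
      have "(a - b)\<^sup>2 \<le> 2 * a\<^sup>2 + 2 * b\<^sup>2" for a b :: real
        using zero_le_power2[of "a + b"] by (simp add: power2_eq_square algebra_simps)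
      then show "AE x in M. norm ((indicator A x - g x)\<^sup>2) \<le> norm (2 * (indicator A x :: real)\<^sup>2 + 2 * (g x)\<^sup>2)"
        by (intro AE_I2) simp
    qed (use A g2 in \<open>auto simp: L2_functions_def\<close>)
    then have "(dist1 M (indicator A) g)\<^sup>2 \<le> (\<integral>x. (indicator A x - g x)\<^sup>2 \<partial>M)"
      by (rule dist1_le_L2[OF L2_int[OF ind[OF A]] L2_int[OF g2]])
    then have "dist1 M (indicator A) g \<le> L2_dist M (indicator A) g"
      unfolding L2_dist_def by (rule real_le_rsqrt)
    moreover obtain i where "g = from_nat_into D i"
      using g(1) range by blast
    ultimately show "\<exists>i. dist1 M (indicator A) (from_nat_into D i) < e"
      using g(2) by (intro exI[of _ i]) simp
  qed
qed

theorem theorem1p6: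
  fixes M :: "'a measure" and B :: "'a set set set"
  assumes "prob_space M"
    and "separable_L2 M"
    and "noise_type_Boolean_algebra M B"
  shows "(\<forall>x :: nat \<Rightarrow> 'a set set. (\<forall>n. x n \<in> Cl M B) \<longrightarrow> sf_Inf M (range x) \<in> Cl M B) \<and>
         (\<forall>x :: nat \<Rightarrow> 'a set set. (\<forall>n. x n \<in> Cl M B) \<and> (\<forall>n. x n \<subseteq> x (Suc n)) \<longrightarrow>
            sf_Sup M (range x) \<in> Cl M B)"
proof -
  interpret prob_space M
    by (rule assms(1))
  interpret commuting_sigma_fields M B
  proof
    show "B \<subseteq> sigma_fields M"
      using assms(3) by (simp add: noise_type_Boolean_algebra_def)
    show "x \<inter> y \<in> B" if "x \<in> B" "y \<in> B" for x y
      using assms(3) that by (simp add: noise_type_Boolean_algebra_def)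
  qed (rule noise_type_cexp_comp[OF assms(3)])
  obtain d :: "nat \<Rightarrow> 'a \<Rightarrow> real" where d: "\<And>i. integrable M (d i)"
    "\<And>A e. A \<in> sets M \<Longrightarrow> e > 0 \<Longrightarrow> \<exists>i. dist1 M (indicator A) (d i) < e"
    using separable_L2_imp_dense_sequence[OF assms(2)] by blast
  have "Cl M B = K"
    using Cl_subset_strong_closure strong_closure_subset_Cl[OF d] by blast
  then show ?thesis
    by (simp add: strong_closure_Inf strong_closure_Sup incseq_SucI)
qed

end
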